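(* Let $d\le m$ be nonnegative integers, let $\nu=(m-d)^d=(m-d,\dots,m-d)$ be a rectangular partition, and let $n=d(m-d)=|\nu|$. Let $z_1,\dots,z_n\in\mathbb{C}$ and let $\phi\in\mathrm{PGL}_2(\mathbb{C})$ be such that $\phi(z_i)\ne\infty$ for $i=1,\dots,n$. Then $$\mathcal{B}_\nu(z_1,\dots,z_n)=\mathcal{B}_\nu(\phi(z_1),\dots,\phi(z_n)).$$
   Context: $\mathrm{PGL}_2(\mathbb{C})$ acts on $\mathbb{P}^1=\mathbb{C}\cup\{\infty\}$ by Möbius transformations, $\begin{pmatrix}a&b\\c&e\end{pmatrix}(w)=\frac{aw+b}{cw+e}$. $[n]=\{1,\dots,n\}$; $M^\lambda$ is the Specht module of $\mathfrak{S}_{|\lambda|}$ attached to $\lambda$, with character $\chi^\lambda$. For $X\subseteq[n]$, $\mathfrak{S}_X\subseteq\mathfrak{S}_n$ is the group of permutations of $X$, and for $|X|=|\lambda|$, $\chi^\lambda$ is regarded as a function on $\mathfrak{S}_X\cong\mathfrak{S}_{|X|}$. Put $\beta^\lambda(t):=\sum_{X\subseteq[n],|X|=|\lambda|}\sum_{\sigma\in\mathfrak{S}_X}\chi^\lambda(\sigma)\sigma\prod_{i\in[n]\setminus X}(z_i+t)\in\mathbb{C}[\mathfrak{S}_n]$. The Bethe algebra $\mathcal{B}_n(z_1,\dots,z_n)$ is the subalgebra of $\mathbb{C}[\mathfrak{S}_n]$ generated by all $\beta^{1^k}(t)$, $k\ge0$, $t\in\mathbb{C}$, and $\mathcal{B}_\nu(z_1,\dots,z_n)\subseteq\mathrm{End}(M^\nu)$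 is the image of its action on $M^\nu$. *)

theory Defs
  imports "HOL-Analysis.Analysis" "HOL-Library.Function_Algebras"
    "HOL-Library.FuncSet" "HOL-Combinatorics.Permutations"
begin

text \<open>
  Both the group algebra of a symmetric group and the permutation module on tabloids are
  modelled inside function spaces \<open>'a \<Rightarrow> complex\<close>, with basis vectors \<open>delta a\<close>.
\<close>

definition fscale :: "complex \<Rightarrow> ('a \<Rightarrow> complex) \<Rightarrow> 'a \<Rightarrow> complex"  (infixr \<open>*\<^sub>F\<close> 75)
  where "c *\<^sub>F f = (\<lambda>x. c * f x)"

definition delta :: "'a \<Rightarrow> 'a \<Rightarrow> complex"
  where "delta a = (\<lambda>x. if x = a then 1 else 0)"

global_interpretation funvs: vector_space "fscale :: complex \<Rightarrow> ('a \<Rightarrow> complex) \<Rightarrow> 'a \<Rightarrow> complex"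
  by unfold_locales (auto simp: fscale_def fun_eq_iff algebra_simps)

text \<open>
  The trace of \<open>f\<close> on a finite-dimensional \<open>f\<close>-invariant subspace \<open>V\<close>, computed in an
  arbitrary basis of \<open>V\<close>.
\<close>

definition trace_on :: "('a \<Rightarrow> complex) set \<Rightarrow> (('a \<Rightarrow> complex) \<Rightarrow> 'a \<Rightarrow> complex) \<Rightarrow> complex"
  where "trace_on V f =
    (let B = (SOME B. funvs.independent B \<and> funvs.span B = V)
     in \<Sum>b\<in>B. funvs.representation B (f b) b)"

text \<open>
  A partition is given by the list of its parts; trailing zeros are harmless, and
  \<open>|\<lambda>|\<close> is \<open>sum_list \<lambda>\<close>. Rows and columns are numbered from \<open>0\<close>.
\<close>

definition diagram :: "nat list \<Rightarrow> (nat \<times> nat) set"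
  where "diagram la = {(i, j). i < length la \<and> j < la ! i}"

text \<open>
  Tableaux are filled with the elements of an arbitrary finite set \<open>X\<close> of size \<open>|\<lambda>|\<close>,
  so that the Specht module and its character are directly available for the group of
  permutations of \<open>X\<close>. Taking \<open>X = {1..n}\<close> gives the usual objects for the symmetric group on
  \<open>n\<close> letters; any bijection from \<open>{1..card X}\<close> to \<open>X\<close> transports one to the other.
\<close>

definition tableaux :: "nat set \<Rightarrow> nat list \<Rightarrow> (nat \<times> nat \<Rightarrow> nat) set"
  where "tableaux X la = {t. bij_betw t (diagram la) X}"

text \<open>A tabloid is the sequence of the sets of entries of the rows of a tableau.\<close>

type_synonym tabloid = "nat \<Rightarrow> nat set"

definition tabloid_of :: "nat list \<Rightarrow> (nat \<times> nat \<Rightarrow> nat) \<Rightarrow> tabloid"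
  where "tabloid_of la t = (\<lambda>i. t ` {c \<in> diagram la. fst c = i})"

definition permute_tabloid :: "(nat \<Rightarrow> nat) \<Rightarrow> tabloid \<Rightarrow> tabloid"
  where "permute_tabloid \<sigma> T = (\<lambda>i. \<sigma> ` T i)"

definition column_stabilizer ::
    "nat set \<Rightarrow> nat list \<Rightarrow> (nat \<times> nat \<Rightarrow> nat) \<Rightarrow> (nat \<Rightarrow> nat) set"
  where "column_stabilizer X la t =
    {\<pi>. \<pi> permutes X \<and>
        (\<forall>j. \<pi> ` (t ` {c \<in> diagram la. snd c = j}) = t ` {c \<in> diagram la. snd c = j})}"

definition polytabloid ::
    "nat set \<Rightarrow> nat list \<Rightarrow> (nat \<times> nat \<Rightarrow> nat) \<Rightarrow> tabloid \<Rightarrow> complex"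
  where "polytabloid X la t =
    (\<Sum>\<pi>\<in>column_stabilizer X la t.
       of_int (sign \<pi>) *\<^sub>F delta (permute_tabloid \<pi> (tabloid_of la t)))"

definition specht :: "nat set \<Rightarrow> nat list \<Rightarrow> (tabloid \<Rightarrow> complex) set"
  where "specht X la = funvs.span (polytabloid X la ` tableaux X la)"

text \<open>
  The linear action of a permutation on combinations of tabloids; because of the inverse,
  \<open>permute_vec \<sigma> (delta T) = delta (permute_tabloid \<sigma> T)\<close> for bijective \<open>\<sigma>\<close>.
\<close>

definition permute_vec :: "(nat \<Rightarrow> nat) \<Rightarrow> (tabloid \<Rightarrow> complex) \<Rightarrow> tabloid \<Rightarrow> complex"
  where "permute_vec \<sigma> v = (\<lambda>T. v (permute_tabloid (inv \<sigma>) T))"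

definition specht_char :: "nat set \<Rightarrow> nat list \<Rightarrow> (nat \<Rightarrow> nat) \<Rightarrow> complex"
  where "specht_char X la \<sigma> = trace_on (specht X la) (permute_vec \<sigma>)"

text \<open>
  Elements of the group algebra of the permutations of \<open>{1..n}\<close> are functions on
  all of \<open>nat \<Rightarrow> nat\<close> that vanish outside these permutations.
\<close>

type_synonym group_alg = "(nat \<Rightarrow> nat) \<Rightarrow> complex"

definition ga_mult :: "nat \<Rightarrow> group_alg \<Rightarrow> group_alg \<Rightarrow> group_alg"
  where "ga_mult n x y =
    (\<Sum>\<sigma> | \<sigma> permutes {1..n}. \<Sum>\<tau> | \<tau> permutes {1..n}. (x \<sigma> * y \<tau>) *\<^sub>F delta (\<sigma> \<circ> \<tau>))"

definition beta :: "nat \<Rightarrow> (nat \<Rightarrow> complex) \<Rightarrow> nat list \<Rightarrow> complex \<Rightarrow> group_alg"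
  where "beta n z la t =
    (\<Sum>X | X \<subseteq> {1..n} \<and> card X = sum_list la. \<Sum>\<sigma> | \<sigma> permutes X.
       (specht_char X la \<sigma> * (\<Prod>i\<in>{1..n} - X. z i + t)) *\<^sub>F delta \<sigma>)"

inductive_set bethe :: "nat \<Rightarrow> (nat \<Rightarrow> complex) \<Rightarrow> group_alg set"
  for n :: nat and z :: "nat \<Rightarrow> complex"
  where
    gen: "beta n z (replicate k 1) t \<in> bethe n z"
  | one: "delta id \<in> bethe n z"
  | scale: "x \<in> bethe n z \<Longrightarrow> c *\<^sub>F x \<in> bethe n z"
  | add: "x \<in> bethe n z \<Longrightarrow> y \<in> bethe n z \<Longrightarrow> x + y \<in> bethe n z"
  | mult: "x \<in> bethe n z \<Longrightarrow> y \<in> bethe n z \<Longrightarrow> ga_mult n x y \<in> bethe n z"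

definition ga_act :: "nat \<Rightarrow> group_alg \<Rightarrow> (tabloid \<Rightarrow> complex) \<Rightarrow> tabloid \<Rightarrow> complex"
  where "ga_act n x v = (\<Sum>\<sigma> | \<sigma> permutes {1..n}. x \<sigma> *\<^sub>F permute_vec \<sigma> v)"

text \<open>
  Endomorphisms of the Specht module are represented by functions that are
  \<open>undefined\<close> outside of it, so that equality of functions is equality of endomorphisms.
\<close>

definition bethe_on ::
    "nat \<Rightarrow> nat list \<Rightarrow> (nat \<Rightarrow> complex) \<Rightarrow> ((tabloid \<Rightarrow> complex) \<Rightarrow> tabloid \<Rightarrow> complex) set"
  where "bethe_on n nu z = (\<lambda>x. restrict (ga_act n x) (specht {1..n} nu)) ` bethe n z"

text \<open>\<open>coord\<close> is unspecified at \<open>Infty\<close>.\<close>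

datatype proj_line = Fin (coord: complex) | Infty

definition proportional :: "complex^2^2 \<Rightarrow> complex^2^2 \<Rightarrow> bool"
  where "proportional A B \<longleftrightarrow> invertible A \<and> invertible B \<and>
    (\<exists>r. r \<noteq> 0 \<and> B = (\<chi> i j. r * A $ i $ j))"

quotient_type pgl2 = "complex^2^2" / partial: proportional
proof (rule part_equivpI)
  show "\<exists>A. proportional A A"
    by (rule exI[of _ "mat 1"]) (auto simp: proportional_def vec_eq_iff invertible_def
        intro!: exI[of _ 1] exI[of _ "mat 1"])
  show "symp proportional"
  proof (rule sympI)
    fix A B :: "complex^2^2" assume AB: "proportional A B"
    then obtain r where r: "r \<noteq> 0" and B: "B = (\<chi> i j. r * A $ i $ j)"
      unfolding proportional_def by blast
    have "A = (\<chi> i j. inverse r * B $ i $ j)"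
      using r by (simp add: B vec_eq_iff)
    moreover have "inverse r \<noteq> 0"
      using r by simp
    ultimately show "proportional B A"
      using AB unfolding proportional_def by blast
  qed
  show "transp proportional"
  proof (rule transpI)
    fix A B C :: "complex^2^2" assume AB: "proportional A B" and BC: "proportional B C"
    from AB obtain r where r: "r \<noteq> 0" and B: "B = (\<chi> i j. r * A $ i $ j)"
      unfolding proportional_def by blast
    from BC obtain s where s: "s \<noteq> 0" and C: "C = (\<chi> i j. s * B $ i $ j)"
      unfolding proportional_def by blast
    have "C = (\<chi> i j. (s * r) * A $ i $ j)"
      by (simp add: B C vec_eq_iff)
    moreover have "s * r \<noteq> 0"
      using r s by simp
    ultimately show "proportional A C"
      using AB BC unfolding proportional_def by blast
  qed
qed

definition moebius_mat :: "complex^2^2 \<Rightarrow> proj_line \<Rightarrow> proj_line"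
  where "moebius_mat A p =
    (let a = A $ 1 $ 1; b = A $ 1 $ 2; c = A $ 2 $ 1; e = A $ 2 $ 2
     in case p of
          Fin w \<Rightarrow> if c * w + e = 0 then Infty else Fin ((a * w + b) / (c * w + e))
        | Infty \<Rightarrow> if c = 0 then Infty else Fin (a / c))"

lift_definition moebius :: "pgl2 \<Rightarrow> proj_line \<Rightarrow> proj_line" is moebius_mat
proof -
  fix A B :: "complex^2^2" assume "proportional A B"
  then obtain r where r: "r \<noteq> 0" and B: "B = (\<chi> i j. r * A $ i $ j)"
    by (auto simp: proportional_def)
  have 1: "r * x * w + r * y = r * (x * w + y)" for x y w
    by (simp add: algebra_simps)
  show "moebius_mat A = moebius_mat B"
    by (rule ext) (simp add: moebius_mat_def B r 1 Let_def split: proj_line.split)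
qed

end

theory Submission
  imports Defs
begin

text \<open>
  Write \<open>P\<^sub>Y\<close> for the sum of \<open>sign \<sigma> \<sigma>\<close> over the permutations of \<open>Y\<close>. As the character of
  \<open>1\<^sup>k\<close> is the sign, the generator \<open>\<beta>\<^sub>k(t)\<close> is the sum of \<open>P\<^sub>X \<Prod>\<^sub>i\<^sub>\<notin>\<^sub>X (z\<^sub>i + t)\<close> over
  \<open>|X| = k\<close>. After a Moebius transformation each \<open>P\<^sub>X\<close> acquires, up to a global factor, an
  additional weight \<open>\<Prod>\<^sub>i\<^sub>\<in>\<^sub>X (c z\<^sub>i + e)\<close>. With \<open>c z\<^sub>i + e = c (z\<^sub>i + s) + \<delta>\<close>
  this weight expands over the subsets \<open>Y\<close> of \<open>X\<close>, so that one has to evaluate the sum of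
  \<open>P\<^sub>X\<close> over all \<open>X \<supseteq> Y\<close> with \<open>|X| = k\<close>. On the Specht module of a \<open>d \<times> l\<close> rectangle this
  sum is a multiple of \<open>P\<^sub>Y\<close> that depends on \<open>|Y|\<close> and \<open>k\<close> only: because a rectangle has a
  single removable corner, every sum \<open>\<Sum>\<^sub>x\<^sub>\<noteq>\<^sub>y (x y)\<close> acts as the scalar \<open>l - d\<close>, whence the sum of
  \<open>P\<close> over the sets \<open>Y \<union> {x}\<close> with \<open>x \<notin> Y\<close> is \<open>(d - |Y|) (l + |Y|) P\<^sub>Y\<close>. So the transformed
  generators are linear combinations of the original ones, and the inverse transformation
  gives the reverse inclusion.
\<close>

hide_const (open) Finite_Cartesian_Product.transpose
hide_fact (open) Finite_Cartesian_Product.transpose_def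

section \<open>Linear calculus in function spaces and the permutation action on polytabloids\<close>

lemma sum_fun_apply: "(\<Sum>i\<in>A. f i) x = (\<Sum>i\<in>A. f i x)"
  for f :: "'i \<Rightarrow> 'a \<Rightarrow> complex"
  by (induction A rule: infinite_finite_induct) auto

lemma fscale_apply: "(c *\<^sub>F f) x = c * f x"
  by (simp add: fscale_def)

lemma sum_constant_fscale: "(\<Sum>i\<in>A. v) = of_nat (card A) *\<^sub>F v"
  by (simp add: fun_eq_iff sum_fun_apply fscale_apply)

lemma comp_transpose:
  assumes "bij \<sigma>"
  shows "\<sigma> \<circ> transpose a b = transpose (\<sigma> a) (\<sigma> b) \<circ> \<sigma>"
  using inj_eq[OF bij_is_inj[OF assms]] by (simp add: fun_eq_iff transpose_def)

lemma permute_vec_apply: "permute_vec \<sigma> v T = v (permute_tabloid (inv \<sigma>) T)"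
  by (simp add: permute_vec_def)

lemma permute_tabloid_comp:
  "permute_tabloid \<sigma> (permute_tabloid \<tau> T) = permute_tabloid (\<sigma> \<circ> \<tau>) T"
  by (simp add: permute_tabloid_def image_comp fun_eq_iff)

lemma permute_tabloid_id [simp]: "permute_tabloid id T = T"
  by (simp add: permute_tabloid_def)

lemma permute_vec_id [simp]: "permute_vec id v = v"
  by (simp add: permute_vec_def)

lemma permute_vec_comp:
  assumes "bij \<sigma>" "bij \<tau>"
  shows "permute_vec (\<sigma> \<circ> \<tau>) v = permute_vec \<sigma> (permute_vec \<tau> v)"
  using assms by (simp add: fun_eq_iff permute_vec_apply permute_tabloid_comp o_inv_distrib)

lemma permute_vec_add: "permute_vec \<sigma> (v + w) = permute_vec \<sigma> v + permute_vec \<sigma> w"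
  and permute_vec_diff: "permute_vec \<sigma> (v - w) = permute_vec \<sigma> v - permute_vec \<sigma> w"
  and permute_vec_uminus: "permute_vec \<sigma> (- v) = - permute_vec \<sigma> v"
  and permute_vec_zero: "permute_vec \<sigma> 0 = 0"
  and permute_vec_scale: "permute_vec \<sigma> (c *\<^sub>F v) = c *\<^sub>F permute_vec \<sigma> v"
  by (simp_all add: fun_eq_iff permute_vec_apply fscale_apply)

lemma permute_vec_sum: "permute_vec \<sigma> (\<Sum>i\<in>A. f i) = (\<Sum>i\<in>A. permute_vec \<sigma> (f i))"
  by (simp add: fun_eq_iff permute_vec_apply sum_fun_apply)

lemma permute_vec_delta:
  assumes "bij \<sigma>"
  shows "permute_vec \<sigma> (delta T) = delta (permute_tabloid \<sigma> T)"
proof -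
  have "permute_tabloid (inv \<sigma>) S = T \<longleftrightarrow> S = permute_tabloid \<sigma> T" for S
    using assms permute_tabloid_comp[of \<sigma> "inv \<sigma>" S] permute_tabloid_comp[of "inv \<sigma>" \<sigma> T]
    by (auto simp: surj_iff[THEN iffD1] inj_iff[THEN iffD1] bij_is_inj bij_is_surj)
  then show ?thesis
    by (simp add: fun_eq_iff permute_vec_apply delta_def)
qed

text \<open>Conjugation by \<open>\<sigma>\<close> carries the column stabilizer of \<open>t\<close>
  onto that of \<open>\<sigma> \<circ> t\<close> and preserves signs, so it reindexes the defining
  sum.\<close>

lemma permute_vec_polytabloid:
  assumes X: "finite X" and \<sigma>: "\<sigma> permutes X" and t: "t \<in> tableaux X la"
  shows "permute_vec \<sigma> (polytabloid X la t) = polytabloid X la (\<sigma> \<circ> t)"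
    and "\<sigma> \<circ> t \<in> tableaux X la"
proof -
  have b\<sigma>: "bij \<sigma>" using \<sigma> by (rule permutes_bij)
  have inv1: "inv \<sigma> \<circ> \<sigma> = id" "\<sigma> \<circ> inv \<sigma> = id"
    using \<sigma> by (simp_all add: permutes_inv_o)
  have tab: "tabloid_of la (\<sigma> \<circ> t) = permute_tabloid \<sigma> (tabloid_of la t)"
    by (simp add: tabloid_of_def permute_tabloid_def image_comp fun_eq_iff)
  \<comment> \<open>Stated for arbitrary \<open>\<rho>\<close> and \<open>u\<close> because the
    reindexing needs it in both directions, for \<open>\<sigma>\<close> and for
    \<open>inv \<sigma>\<close>.\<close>
  have conj_stab: "\<rho> \<circ> \<pi> \<circ> inv \<rho> \<in> column_stabilizer X la (\<rho> \<circ> u)"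
    if \<rho>: "\<rho> permutes X" and \<pi>: "\<pi> \<in> column_stabilizer X la u" for \<rho> \<pi> u
  proof -
    have "(\<rho> \<circ> \<pi> \<circ> inv \<rho>) ` ((\<rho> \<circ> u) ` C) = (\<rho> \<circ> u) ` C" if "\<pi> ` (u ` C) = u ` C" for C
    proof -
      have "(\<rho> \<circ> \<pi> \<circ> inv \<rho>) ` ((\<rho> \<circ> u) ` C) = \<rho> ` (\<pi> ` ((inv \<rho> \<circ> \<rho>) ` (u ` C)))"
        by (simp only: image_comp comp_assoc)
      also have "\<dots> = (\<rho> \<circ> u) ` C"
        using \<rho> that by (simp add: permutes_inv_o image_image)
      finally show ?thesis .
    qed
    then show ?thesis
      using \<rho> \<pi> by (auto simp: column_stabilizer_def intro!: permutes_compose permutes_inv)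
  qed
  have "permute_vec \<sigma> (polytabloid X la t) =
      (\<Sum>\<pi>\<in>column_stabilizer X la t. of_int (sign \<pi>) *\<^sub>F
        delta (permute_tabloid \<sigma> (permute_tabloid \<pi> (tabloid_of la t))))"
    using b\<sigma> by (simp add: polytabloid_def permute_vec_sum permute_vec_scale permute_vec_delta)
  also have "\<dots> = polytabloid X la (\<sigma> \<circ> t)"
    unfolding polytabloid_def
  proof (rule sum.reindex_bij_witness[where i = "\<lambda>\<pi>. inv \<sigma> \<circ> \<pi> \<circ> \<sigma>" and j = "\<lambda>\<pi>. \<sigma> \<circ> \<pi> \<circ> inv \<sigma>"])
    fix \<pi> assume \<pi>: "\<pi> \<in> column_stabilizer X la t"
    show "inv \<sigma> \<circ> (\<sigma> \<circ> \<pi> \<circ> inv \<sigma>) \<circ> \<sigma> = \<pi>"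
      by (metis comp_assoc comp_id id_comp inv1(1))
    show "\<sigma> \<circ> \<pi> \<circ> inv \<sigma> \<in> column_stabilizer X la (\<sigma> \<circ> t)"
      using \<sigma> \<pi> by (rule conj_stab)
    have p: "permutation \<pi>" "permutation \<sigma>" "permutation (inv \<sigma>)"
      using \<pi> \<sigma> X permutes_inv[OF \<sigma>]
      by (auto simp: column_stabilizer_def permutation_permutes)
    have "sign (\<sigma> \<circ> \<pi> \<circ> inv \<sigma>) = sign \<pi>"
      using p by (simp add: sign_compose permutation_compose sign_inverse sign_idempotent)
    moreover have "permute_tabloid (\<sigma> \<circ> \<pi> \<circ> inv \<sigma>) (tabloid_of la (\<sigma> \<circ> t)) =
        permute_tabloid \<sigma> (permute_tabloid \<pi> (tabloid_of la t))"
      unfolding tab permute_tabloid_comp by (metis comp_assoc comp_id inv1(1))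
    ultimately show "of_int (sign (\<sigma> \<circ> \<pi> \<circ> inv \<sigma>)) *\<^sub>F
        delta (permute_tabloid (\<sigma> \<circ> \<pi> \<circ> inv \<sigma>) (tabloid_of la (\<sigma> \<circ> t))) =
        of_int (sign \<pi>) *\<^sub>F delta (permute_tabloid \<sigma> (permute_tabloid \<pi> (tabloid_of la t)))"
      by simp
  next
    fix \<pi> assume \<pi>: "\<pi> \<in> column_stabilizer X la (\<sigma> \<circ> t)"
    show "\<sigma> \<circ> (inv \<sigma> \<circ> \<pi> \<circ> \<sigma>) \<circ> inv \<sigma> = \<pi>"
      by (metis comp_assoc comp_id id_comp inv1(2))
    have "inv \<sigma> \<circ> (\<sigma> \<circ> t) = t"
      by (metis comp_assoc id_comp inv1(1))
    with conj_stab[OF permutes_inv[OF \<sigma>] \<pi>] show "inv \<sigma> \<circ> \<pi> \<circ> \<sigma> \<in> column_stabilizer X la t"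
      using \<sigma> by (simp add: permutes_inv_inv)
  qed
  finally show "permute_vec \<sigma> (polytabloid X la t) = polytabloid X la (\<sigma> \<circ> t)" .
  show "\<sigma> \<circ> t \<in> tableaux X la"
    using t permutes_imp_bij[OF \<sigma>] by (auto simp: tableaux_def intro: bij_betw_trans)
qed

text \<open>Left multiplication by \<open>\<rho>\<close> permutes the column stabilizer and
  multiplies every sign by \<open>sign \<rho>\<close>.\<close>

lemma permute_vec_column_stabilizer:
  assumes X: "finite X" and \<rho>: "\<rho> \<in> column_stabilizer X la t"
  shows "permute_vec \<rho> (polytabloid X la t) = of_int (sign \<rho>) *\<^sub>F polytabloid X la t"
proof -
  have p: "\<rho> permutes X" using \<rho> by (simp add: column_stabilizer_def)
  have bij: "bij \<rho>" using p by (rule permutes_bij)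
  have comp: "\<pi> \<circ> \<pi>' \<in> column_stabilizer X la t"
    if "\<pi> \<in> column_stabilizer X la t" "\<pi>' \<in> column_stabilizer X la t" for \<pi> \<pi>'
    using that unfolding column_stabilizer_def by (simp add: image_comp[symmetric] permutes_compose del: comp_apply)
  have inv: "inv \<rho> \<in> column_stabilizer X la t"
  proof -
    have "inv \<rho> ` A = A" if "\<rho> ` A = A" for A
      using bij that by (metis bij_is_inj image_inv_f_f)
    then show ?thesis using \<rho> by (simp add: column_stabilizer_def permutes_inv)
  qed
  have "permute_vec \<rho> (polytabloid X la t) =
      (\<Sum>\<pi>\<in>column_stabilizer X la t. of_int (sign \<pi>) *\<^sub>F
        delta (permute_tabloid \<rho> (permute_tabloid \<pi> (tabloid_of la t))))"
    using bij by (simp add: polytabloid_def permute_vec_sum permute_vec_scale permute_vec_delta)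
  also have "\<dots> = (\<Sum>\<pi>\<in>column_stabilizer X la t. of_int (sign \<rho>) *\<^sub>F of_int (sign \<pi>) *\<^sub>F
        delta (permute_tabloid \<pi> (tabloid_of la t)))"
  proof (rule sum.reindex_bij_witness[where i = "\<lambda>\<pi>. inv \<rho> \<circ> \<pi>" and j = "\<lambda>\<pi>. \<rho> \<circ> \<pi>"])
    fix \<pi> assume \<pi>: "\<pi> \<in> column_stabilizer X la t"
    show "inv \<rho> \<circ> (\<rho> \<circ> \<pi>) = \<pi>" "\<rho> \<circ> (inv \<rho> \<circ> \<pi>) = \<pi>"
      using p by (simp_all add: comp_assoc[symmetric] permutes_inv_o)
    show "\<rho> \<circ> \<pi> \<in> column_stabilizer X la t" "inv \<rho> \<circ> \<pi> \<in> column_stabilizer X la t"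
      using \<rho> inv \<pi> by (auto intro: comp)
    have "permutation \<pi>" "permutation \<rho>"
      using \<pi> p X by (auto simp: column_stabilizer_def permutation_permutes)
    then have "complex_of_int (sign \<rho>) * of_int (sign (\<rho> \<circ> \<pi>)) = of_int (sign \<pi>)"
      by (simp add: sign_compose mult.assoc[symmetric] sign_idempotent flip: of_int_mult)
    then show "of_int (sign \<rho>) *\<^sub>F of_int (sign (\<rho> \<circ> \<pi>)) *\<^sub>F
        delta (permute_tabloid (\<rho> \<circ> \<pi>) (tabloid_of la t)) =
        of_int (sign \<pi>) *\<^sub>F delta (permute_tabloid \<rho> (permute_tabloid \<pi> (tabloid_of la t)))"
      by (simp add: funvs.scale_scale permute_tabloid_comp)
  qed
  also have "\<dots> = of_int (sign \<rho>) *\<^sub>F polytabloid X la t"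
    by (simp add: polytabloid_def funvs.scale_sum_right)
  finally show ?thesis .
qed

lemma subspace_specht: "funvs.subspace (specht X la)"
  by (simp add: specht_def funvs.subspace_span)

lemma permute_vec_specht:
  assumes X: "finite X" and \<sigma>: "\<sigma> permutes X" and v: "v \<in> specht X la"
  shows "permute_vec \<sigma> v \<in> specht X la"
  using v unfolding specht_def
proof (induction rule: funvs.span_induct_alt)
  case base
  show ?case unfolding permute_vec_zero by (rule funvs.span_zero)
next
  case (step c x y)
  then obtain t where "t \<in> tableaux X la" "x = polytabloid X la t" by blast
  then have "permute_vec \<sigma> x \<in> funvs.span (polytabloid X la ` tableaux X la)"
    using permute_vec_polytabloid[OF X \<sigma>] by (auto intro: funvs.span_base)
  with step show ?case
    unfolding permute_vec_add permute_vec_scale by (intro funvs.span_add funvs.span_scale)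
qed

subsection \<open>The sign character\<close>

lemma diagram_column: "diagram (replicate k (Suc 0)) = (\<lambda>i. (i, 0)) ` {..<k}"
  by (auto simp: diagram_def)

text \<open>With a single column every permutation of \<open>X\<close> is a column permutation, so
  the Specht module is the line spanned by one polytabloid, and \<open>\<sigma>\<close> acts on it
  by its sign.\<close>

lemma specht_char_column:
  assumes X: "finite X" "card X = k" and \<sigma>: "\<sigma> permutes X"
  shows "specht_char X (replicate k 1) \<sigma> = of_int (sign \<sigma>)"
proof -
  let ?la = "replicate k (Suc 0)"
  have stab: "column_stabilizer X ?la t = {\<pi>. \<pi> permutes X}" if t: "t \<in> tableaux X ?la" for t
  proof -
    have "t ` {c \<in> diagram ?la. snd c = j} = (if j = 0 then X else {})" for j
      using t by (auto simp: tableaux_def bij_betw_def diagram_column image_image)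
    then have "column_stabilizer X ?la t =
        {\<pi>. \<pi> permutes X \<and> (\<forall>j::nat. \<pi> ` (if j = 0 then X else {}) = (if j = 0 then X else {}))}"
      unfolding column_stabilizer_def by presburger
    moreover have "\<pi> ` (if j = 0 then X else {}) = (if j = 0 then X else {})"
      if "\<pi> permutes X" for \<pi> and j :: nat
      using permutes_image[OF that] by simp
    ultimately show ?thesis by blast
  qed
  have "inj_on (\<lambda>i. (i, 0::nat)) {..<k}" by (simp add: inj_on_def)
  then have "card (diagram ?la) = k" by (simp add: diagram_column card_image)
  moreover have "finite (diagram ?la)" by (simp add: diagram_column)
  ultimately obtain t where "bij_betw t (diagram ?la) X"
    using X by (metis finite_same_card_bij)
  then have t: "t \<in> tableaux X ?la" by (simp add: tableaux_def)
  let ?e = "polytabloid X ?la t"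
  have e_ne: "?e \<noteq> 0"
  proof -
    let ?T = "tabloid_of ?la t"
    \<comment> \<open>The rows of this tabloid are singletons, so only the identity fixes it and its
      coefficient in the polytabloid is \<open>sign id\<close>, that is 1.\<close>
    have "?T = permute_tabloid \<pi> ?T \<longleftrightarrow> \<pi> = id" if \<pi>: "\<pi> permutes X" for \<pi>
    proof
      assume eq: "?T = permute_tabloid \<pi> ?T"
      have "\<pi> x = x" if "x \<in> X" for x
      proof -
        obtain i where i: "i < k" "x = t (i, 0)"
          using t \<open>x \<in> X\<close> by (auto simp: tableaux_def bij_betw_def diagram_column)
        then have "{c \<in> diagram ?la. fst c = i} = {(i, 0)}"
          by (auto simp: diagram_column)
        then have "?T i = {x}" by (simp add: tabloid_of_def i)
        then have "{x} = \<pi> ` {x}" using fun_cong[OF eq, of i] unfolding permute_tabloid_def by argo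
        then show ?thesis by blast
      qed
      then have "\<pi> x = id x" for x
        using permutes_not_in[OF \<pi>] by (cases "x \<in> X") simp_all
      then show "\<pi> = id" by (rule ext)
    qed simp
    then have "?e ?T = (\<Sum>\<pi> | \<pi> permutes X. if \<pi> = id then 1 else 0)"
      unfolding polytabloid_def stab[OF t]
      by (auto simp: sum_fun_apply fscale_apply delta_def sign_id intro!: sum.cong)
    also have "\<dots> = 1"
      using X by (simp add: finite_permutations permutes_id)
    finally show ?thesis by auto
  qed
  have span: "specht X ?la = funvs.span {?e}"
  proof -
    have "polytabloid X ?la u \<in> funvs.span {?e}" if u: "u \<in> tableaux X ?la" for u
    proof -
      \<comment> \<open>Any two tableaux differ by a permutation of \<open>X\<close>, here extended
        by the identity. As functions \<open>\<rho> \<circ> t\<close> and \<open>u\<close> agree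
        only on the diagram, which is all that the polytabloid sees.\<close>
      define \<rho> where "\<rho> x = (if x \<in> X then u (inv_into (diagram ?la) t x) else x)" for x
      have "bij_betw (u \<circ> inv_into (diagram ?la) t) X X"
        using t u by (auto simp: tableaux_def intro: bij_betw_trans bij_betw_inv_into)
      then have "bij_betw \<rho> X X"
        by (subst bij_betw_cong[of _ _ "u \<circ> inv_into (diagram ?la) t"]) (auto simp: \<rho>_def)
      then have \<rho>: "\<rho> permutes X"
        by (rule bij_imp_permutes) (simp add: \<rho>_def)
      have \<rho>t: "(\<rho> \<circ> t) c = u c" if "c \<in> diagram ?la" for c
        using t that by (auto simp: \<rho>_def tableaux_def bij_betw_def inv_into_f_f)
      then have "(\<rho> \<circ> t) ` {c \<in> diagram ?la. Q c} = u ` {c \<in> diagram ?la. Q c}" for Q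
        by (intro image_cong) auto
      then have "polytabloid X ?la (\<rho> \<circ> t) = polytabloid X ?la u"
        by (simp add: polytabloid_def tabloid_of_def column_stabilizer_def)
      then have "polytabloid X ?la u = of_int (sign \<rho>) *\<^sub>F ?e"
        using permute_vec_polytabloid(1)[OF X(1) \<rho> t] permute_vec_column_stabilizer[OF X(1), of \<rho> ?la t] \<rho>
        by (simp add: stab[OF t])
      then show ?thesis by (simp add: funvs.span_scale funvs.span_base)
    qed
    then show ?thesis
      unfolding specht_def using t
      by (intro antisym funvs.span_minimal funvs.subspace_span) (auto intro: funvs.span_base)
  qed
  have act: "permute_vec \<sigma> v = of_int (sign \<sigma>) *\<^sub>F v" if v: "v \<in> specht X ?la" for v
  proof -
    obtain c where "v = c *\<^sub>F ?e"
      using v unfolding span funvs.span_singleton by blast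
    then show ?thesis
      using permute_vec_column_stabilizer[OF X(1), of \<sigma> ?la t] \<sigma>
      by (simp add: stab[OF t] permute_vec_scale funvs.scale_left_commute)
  qed
  have ind_e: "funvs.independent {?e}" using e_ne by (simp add: funvs.independent_insert)
  \<comment> \<open>This is the basis chosen inside \<open>trace_on\<close>. Only its independence
    and span are known; comparing dimensions with \<open>{?e}\<close> shows that it has one
    element.\<close>
  define B where "B = (SOME B. funvs.independent B \<and> funvs.span B = specht X ?la)"
  have B: "funvs.independent B" "funvs.span B = specht X ?la"
    using someI[of "\<lambda>B. funvs.independent B \<and> funvs.span B = specht X ?la" "{?e}"] ind_e span
    by (simp_all add: B_def)
  have "card B = funvs.dim (specht X ?la)"
    using B by (metis funvs.dim_eq_card funvs.span_span)
  also have "\<dots> = card {?e}"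
    using ind_e span by (metis funvs.dim_eq_card funvs.span_span)
  finally have cB: "card B = 1" by simp
  have "specht_char X ?la \<sigma> = (\<Sum>b\<in>B. funvs.representation B (permute_vec \<sigma> b) b)"
    by (simp add: specht_char_def trace_on_def B_def Let_def)
  also have "\<dots> = (\<Sum>b\<in>B. of_int (sign \<sigma>))"
  proof (rule sum.cong[OF refl])
    fix b assume b: "b \<in> B"
    then have "b \<in> specht X ?la" using B(2) funvs.span_base by blast
    then have "funvs.representation B (permute_vec \<sigma> b) b = funvs.representation B (of_int (sign \<sigma>) *\<^sub>F b) b"
      by (simp add: act)
    also have "\<dots> = of_int (sign \<sigma>)"
      using B(1) b by (simp add: funvs.representation_scale funvs.span_base funvs.representation_basis)
    finally show "funvs.representation B (permute_vec \<sigma> b) b = of_int (sign \<sigma>)" .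
  qed
  also have "\<dots> = of_int (sign \<sigma>)" by (simp add: cB)
  finally show ?thesis by simp
qed

subsection \<open>Straightening in the Specht module of a rectangle\<close>

text \<open>This keeps exactly what the pigeonhole argument in \<open>antisymmetric_eq_0\<close>
  uses of a tabloid, and it is stable under permutations of \<open>X\<close>.\<close>

definition row_partition :: "nat \<Rightarrow> nat set \<Rightarrow> tabloid \<Rightarrow> bool"
  where "row_partition d X T \<longleftrightarrow>
    (\<forall>x\<in>X. \<exists>i<d. x \<in> T i) \<and> (\<forall>i j x. x \<in> T i \<longrightarrow> x \<in> T j \<longrightarrow> i = j)"

lemma row_partition_permute:
  assumes T: "row_partition d X T" and \<sigma>: "\<sigma> permutes X"
  shows "row_partition d X (permute_tabloid \<sigma> T)"
  unfolding row_partition_def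
proof (intro conjI ballI allI impI)
  fix x assume "x \<in> X"
  then have "inv \<sigma> x \<in> X" using \<sigma> by (simp add: permutes_inv permutes_in_image)
  then obtain i where "i < d" "inv \<sigma> x \<in> T i" using T unfolding row_partition_def by blast
  moreover have "x = \<sigma> (inv \<sigma> x)" using \<sigma> by (simp add: permutes_inverses)
  ultimately show "\<exists>i<d. x \<in> permute_tabloid \<sigma> T i"
    unfolding permute_tabloid_def by blast
next
  fix i j x assume "x \<in> permute_tabloid \<sigma> T i" "x \<in> permute_tabloid \<sigma> T j"
  then obtain u v where "u \<in> T i" "v \<in> T j" "\<sigma> u = \<sigma> v"
    by (auto simp: permute_tabloid_def)
  then show "i = j"
    using T permutes_inj[OF \<sigma>] unfolding row_partition_def inj_def by blast
qed

lemma row_partition_tabloid_of: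
  assumes t: "t \<in> tableaux X la"
  shows "row_partition (length la) X (tabloid_of la t)"
  unfolding row_partition_def
proof (intro conjI ballI allI impI)
  fix x assume "x \<in> X"
  then obtain c where c: "c \<in> diagram la" "x = t c"
    using t by (auto simp: tableaux_def bij_betw_def)
  then have "fst c < length la" "x \<in> tabloid_of la t (fst c)"
    by (auto simp: diagram_def tabloid_of_def)
  then show "\<exists>i<length la. x \<in> tabloid_of la t i" by blast
next
  fix i j x assume "x \<in> tabloid_of la t i" "x \<in> tabloid_of la t j"
  then obtain c c' where "c \<in> diagram la" "c' \<in> diagram la" "fst c = i" "fst c' = j" "t c = t c'"
    unfolding tabloid_of_def by auto
  then show "i = j"
    using t unfolding tableaux_def bij_betw_def inj_on_def by blast
qed

lemma row_partition_polytabloid: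
  assumes t: "t \<in> tableaux X la" and T: "polytabloid X la t T \<noteq> 0"
  shows "row_partition (length la) X T"
proof -
  obtain \<pi> where "\<pi> \<in> column_stabilizer X la t"
      "(of_int (sign \<pi>) *\<^sub>F delta (permute_tabloid \<pi> (tabloid_of la t))) T \<noteq> 0"
    using T unfolding polytabloid_def sum_fun_apply by (meson sum.neutral)
  then have "\<pi> permutes X" "T = permute_tabloid \<pi> (tabloid_of la t)"
    by (auto simp: column_stabilizer_def fscale_apply delta_def split: if_splits)
  then show ?thesis
    using row_partition_permute row_partition_tabloid_of[OF t] by blast
qed

text \<open>By the pigeonhole principle two letters of \<open>S\<close> share a row of any tabloid
  \<open>T\<close> in the support. Their transposition fixes \<open>T\<close>, so the coefficient of
  \<open>T\<close> equals its own negative.\<close>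

lemma antisymmetric_eq_0:
  assumes S: "finite S" "card S > d" "S \<subseteq> X"
    and anti: "\<And>a b. a \<in> S \<Longrightarrow> b \<in> S \<Longrightarrow> a \<noteq> b \<Longrightarrow> permute_vec (transpose a b) w = - w"
    and supp: "\<And>T. w T \<noteq> 0 \<Longrightarrow> row_partition d X T"
  shows "w = 0"
proof (rule ccontr)
  assume "w \<noteq> 0"
  then obtain T where wT: "w T \<noteq> 0" by (auto simp: fun_eq_iff)
  then have T: "row_partition d X T" by (rule supp)
  then have "\<forall>x\<in>S. \<exists>i. i < d \<and> x \<in> T i" using S(3) unfolding row_partition_def by blast
  then obtain r where r: "\<And>x. x \<in> S \<Longrightarrow> r x < d \<and> x \<in> T (r x)" by metis
  then have "r ` S \<subseteq> {..<d}" by auto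
  then have "card (r ` S) \<le> d" using card_mono[of "{..<d}" "r ` S"] by simp
  then have "\<not> inj_on r S" using S pigeonhole[of r S] by simp
  then obtain a b where ab: "a \<in> S" "b \<in> S" "a \<noteq> b" "r a = r b" by (auto simp: inj_on_def)
  then have rows: "a \<in> T (r a)" "b \<in> T (r a)" using r[of a] r[of b] by auto
  have "transpose a b ` T i = T i" for i
  proof (cases "i = r a")
    case True
    with rows show ?thesis by simp
  next
    case False
    then have "a \<notin> T i" "b \<notin> T i" using T rows unfolding row_partition_def by blast+
    then show ?thesis by simp
  qed
  then have "permute_vec (transpose a b) w T = w T"
    by (simp add: permute_vec_apply permute_tabloid_def)
  moreover have "permute_vec (transpose a b) w T = - w T"
    using fun_cong[OF anti[OF ab(1-3)], of T] by simp
  ultimately show False using wT by simp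
qed

abbreviation tableau_column :: "nat list \<Rightarrow> (nat \<times> nat \<Rightarrow> nat) \<Rightarrow> nat \<Rightarrow> nat set"
  where "tableau_column la t j \<equiv> t ` {c \<in> diagram la. snd c = j}"

lemma tableau_column_subset: "t \<in> tableaux X la \<Longrightarrow> tableau_column la t j \<subseteq> X"
  by (auto simp: tableaux_def bij_betw_def)

lemma tableau_column_disjoint:
  assumes "t \<in> tableaux X la" "x \<in> tableau_column la t i" "x \<in> tableau_column la t j"
  shows "i = j"
  using assms unfolding tableaux_def bij_betw_def inj_on_def by blast

lemma transpose_tableau_column:
  assumes X: "finite X" and t: "t \<in> tableaux X la"
    and ab: "a \<in> tableau_column la t j" "b \<in> tableau_column la t j" "a \<noteq> b"
  shows "permute_vec (transpose a b) (polytabloid X la t) = - polytabloid X la t"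
proof -
  have "transpose a b ` tableau_column la t i = tableau_column la t i" for i
  proof (cases "i = j")
    case True
    with ab show ?thesis by simp
  next
    case False
    then have "a \<notin> tableau_column la t i" "b \<notin> tableau_column la t i"
      using tableau_column_disjoint[OF t] ab by blast+
    then show ?thesis by simp
  qed
  moreover have "a \<in> X" "b \<in> X"
    using ab tableau_column_subset[OF t] by blast+
  ultimately have "transpose a b \<in> column_stabilizer X la t"
    by (simp add: column_stabilizer_def permutes_swap_id)
  from permute_vec_column_stabilizer[OF X this] ab(3) show ?thesis
    by (simp add: sign_swap_id)
qed

text \<open>The difference \<open>w\<close> of the two sides is antisymmetric in more letters than there are rows.\<close>

lemma garnir:
  assumes X: "finite X" and t: "t \<in> tableaux X la"
    and height: "card (tableau_column la t j) = length la"
    and y: "y \<in> X" "y \<notin> tableau_column la t j"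
  shows "(\<Sum>x\<in>tableau_column la t j. permute_vec (transpose x y) (polytabloid X la t)) = polytabloid X la t"
proof -
  define C where "C = tableau_column la t j"
  define e where "e = polytabloid X la t"
  have C: "finite C" "C \<subseteq> X" "card C = length la" "y \<notin> C"
    using height y tableau_column_subset[OF t] finite_subset[OF tableau_column_subset[OF t] X]
    by (simp_all only: C_def not_False_eq_True)
  have col: "permute_vec (transpose a b) e = - e" if "a \<in> C" "b \<in> C" "a \<noteq> b" for a b
    using transpose_tableau_column[OF X t] that unfolding C_def e_def by blast
  define w where "w = e - (\<Sum>x\<in>C. permute_vec (transpose x y) e)"
  \<comment> \<open>Conjugation by \<open>(a b)\<close> fixes \<open>y\<close> and permutes the
    summands over the column, while \<open>(a b)\<close> itself negates \<open>e\<close>.\<close>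
  have antiC: "permute_vec (transpose a b) w = - w" if ab: "a \<in> C" "b \<in> C" "a \<noteq> b" for a b
  proof -
    have "(\<Sum>x\<in>C. permute_vec (transpose a b) (permute_vec (transpose x y) e)) =
        (\<Sum>x\<in>C. - permute_vec (transpose (transpose a b x) y) e)"
    proof (rule sum.cong[OF refl])
      fix x assume "x \<in> C"
      have "transpose a b y = y" using ab C by (auto simp: transpose_def)
      then have "permute_vec (transpose a b) (permute_vec (transpose x y) e) =
          permute_vec (transpose (transpose a b x) y) (permute_vec (transpose a b) e)"
        using comp_transpose[of "transpose a b" x y] by (simp flip: permute_vec_comp)
      then show "permute_vec (transpose a b) (permute_vec (transpose x y) e) =
          - permute_vec (transpose (transpose a b x) y) e"
        by (simp only: col[OF ab] permute_vec_uminus)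
    qed
    also have "\<dots> = - (\<Sum>x\<in>C. permute_vec (transpose (transpose a b x) y) e)"
      by (rule sum_negf)
    also have "(\<Sum>x\<in>C. permute_vec (transpose (transpose a b x) y) e) =
        (\<Sum>x\<in>C. permute_vec (transpose x y) e)"
      using ab by (intro sum.reindex_bij_witness[where i = "transpose a b" and j = "transpose a b"])
        (auto simp: transpose_def)
    finally show ?thesis
      unfolding w_def permute_vec_diff permute_vec_sum col[OF ab]
      by (simp only: minus_diff_eq diff_minus_eq_add uminus_add_conv_diff)
  qed
  \<comment> \<open>The transposition \<open>(a y)\<close> exchanges \<open>e\<close> with the
    summand \<open>x = a\<close>. For the other summands \<open>(a y)(x y) = (x y)(x a)\<close>, and
    \<open>(x a)\<close> is a column transposition that negates \<open>e\<close>.\<close>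
  have antiy: "permute_vec (transpose a y) w = - w" if a: "a \<in> C" for a
  proof -
    have "permute_vec (transpose a y) (permute_vec (transpose x y) e) =
        - permute_vec (transpose x y) e" if x: "x \<in> C - {a}" for x
    proof -
      have "transpose a y \<circ> transpose x y = transpose x y \<circ> transpose x a"
      proof -
        have "x \<noteq> a" "x \<noteq> y" "a \<noteq> y" using x a C by auto
        then have "transpose x y a = a" by simp
        then show ?thesis
          using comp_transpose[of "transpose x y" x a] by (simp add: transpose_commute)
      qed
      then have "permute_vec (transpose a y) (permute_vec (transpose x y) e) =
          permute_vec (transpose x y) (permute_vec (transpose x a) e)"
        by (simp flip: permute_vec_comp)
      also have "\<dots> = - permute_vec (transpose x y) e"
        using x a by (subst col) (auto simp only: permute_vec_uminus)
      finally show ?thesis .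
    qed
    then have "(\<Sum>x\<in>C - {a}. permute_vec (transpose a y) (permute_vec (transpose x y) e)) =
        - (\<Sum>x\<in>C - {a}. permute_vec (transpose x y) e)"
      unfolding sum_negf[symmetric] by (rule sum.cong[OF refl])
    moreover have "permute_vec (transpose a y) (permute_vec (transpose a y) e) = e"
      by (simp flip: permute_vec_comp)
    ultimately show ?thesis
      unfolding w_def permute_vec_diff sum.remove[OF C(1) a] permute_vec_add permute_vec_sum
      by (simp only:) (simp add: fun_eq_iff)
  qed
  have "w = 0"
  proof (rule antisymmetric_eq_0)
    \<comment> \<open>The column has full height, so adding \<open>y\<close> gives one letter more
      than there are rows.\<close>
    show "finite (insert y C)" "length la < card (insert y C)" "insert y C \<subseteq> X"
      using C y by auto
    show "permute_vec (transpose a b) w = - w"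
      if "a \<in> insert y C" "b \<in> insert y C" "a \<noteq> b" for a b
      using that antiC antiy by (auto simp: transpose_commute)
    show "row_partition (length la) X T" if T: "w T \<noteq> 0" for T
    \<comment> \<open>The support of \<open>w\<close> lies in the union of the supports of
      \<open>e\<close> and of its transposed copies, which are polytabloids again.\<close>
    proof (cases "e T = 0")
      case True
      with T have "(\<Sum>x\<in>C. permute_vec (transpose x y) e) T \<noteq> 0" by (auto simp: w_def)
      then obtain x where x: "x \<in> C" "permute_vec (transpose x y) e T \<noteq> 0"
        unfolding sum_fun_apply by (meson sum.neutral)
      then have "transpose x y permutes X" using C y by (auto intro: permutes_swap_id)
      with x(2) show ?thesis
        using permute_vec_polytabloid[OF X _ t] row_partition_polytabloid unfolding e_def by metis
    next
      case False
      then show ?thesis using row_partition_polytabloid[OF t] unfolding e_def by blast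
    qed
  qed
  then show ?thesis unfolding w_def C_def e_def by simp
qed

lemma diagram_rectangle: "diagram (replicate d l) = {..<d} \<times> {..<l}"
  by (auto simp: diagram_def)

lemma card_tableau_column_rectangle:
  assumes t: "t \<in> tableaux X (replicate d l)" and j: "j < l"
  shows "card (tableau_column (replicate d l) t j) = d"
proof -
  have "{c \<in> diagram (replicate d l). snd c = j} = (\<lambda>i. (i, j)) ` {..<d}"
    using j by (auto simp: diagram_rectangle)
  moreover have "inj_on (\<lambda>i. (i, j)) {..<d}" by (simp add: inj_on_def)
  moreover have "inj_on t {c \<in> diagram (replicate d l). snd c = j}"
    using t by (auto simp: tableaux_def bij_betw_def intro: inj_on_subset)
  ultimately show ?thesis by (simp add: card_image)
qed

text \<open>The scalar is the content of the unique removable corner of the rectangle.\<close>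

lemma jucys_murphy_rectangle:
  assumes X: "finite X" and y: "y \<in> X" and v: "v \<in> specht X (replicate d l)"
  shows "(\<Sum>x\<in>X - {y}. permute_vec (transpose x y) v) = (of_nat l - of_nat d) *\<^sub>F v"
  using v unfolding specht_def
proof (induction rule: funvs.span_induct_alt)
  case base
  show ?case unfolding permute_vec_zero by (simp add: fun_eq_iff fscale_apply sum_fun_apply)
next
  case (step c u v)
  let ?la = "replicate d l"
  obtain t where t: "t \<in> tableaux X ?la" and u: "u = polytabloid X ?la t"
    using step(1) by blast
  have cover: "X = (\<Union>j\<in>{..<l}. tableau_column ?la t j)"
    using t by (auto simp: tableaux_def bij_betw_def diagram_rectangle)
  then obtain j where j: "j < l" "y \<in> tableau_column ?la t j" using y by blast
  let ?f = "\<lambda>x. permute_vec (transpose x y) u"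
  have fin: "finite (tableau_column ?la t i)" for i
    using finite_subset[OF tableau_column_subset[OF t] X] .
  have split: "X - {y} = (tableau_column ?la t j - {y}) \<union> (\<Union>i\<in>{..<l} - {j}. tableau_column ?la t i)"
  proof -
    have "X = tableau_column ?la t j \<union> (\<Union>i\<in>{..<l} - {j}. tableau_column ?la t i)"
      using cover j by blast
    moreover have "y \<notin> tableau_column ?la t i" if "i \<in> {..<l} - {j}" for i
      using tableau_column_disjoint[OF t j(2)] that by blast
    ultimately show ?thesis by blast
  qed
  \<comment> \<open>The column containing \<open>y\<close> contributes \<open>-(d - 1)\<close> by
    antisymmetry, and each of the \<open>l - 1\<close> other columns contributes 1 by
    \<open>garnir\<close>; the total is \<open>l - d\<close>.\<close>
  have "(\<Sum>x\<in>X - {y}. ?f x) =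
      (\<Sum>x\<in>tableau_column ?la t j - {y}. ?f x) + (\<Sum>x\<in>(\<Union>i\<in>{..<l} - {j}. tableau_column ?la t i). ?f x)"
    unfolding split
  proof (rule sum.union_disjoint)
    show "(tableau_column ?la t j - {y}) \<inter> (\<Union>i\<in>{..<l} - {j}. tableau_column ?la t i) = {}"
      using tableau_column_disjoint[OF t] by blast
  qed (use fin in auto)
  also have "(\<Sum>x\<in>(\<Union>i\<in>{..<l} - {j}. tableau_column ?la t i). ?f x) =
      (\<Sum>i\<in>{..<l} - {j}. \<Sum>x\<in>tableau_column ?la t i. ?f x)"
    using fin tableau_column_disjoint[OF t] by (intro sum.UNION_disjoint) blast+
  also have "\<dots> = (\<Sum>i\<in>{..<l} - {j}. u)"
  proof (rule sum.cong[OF refl])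
    fix i assume i: "i \<in> {..<l} - {j}"
    then have "y \<notin> tableau_column ?la t i" using tableau_column_disjoint[OF t j(2)] by blast
    with i show "(\<Sum>x\<in>tableau_column ?la t i. ?f x) = u"
      unfolding u using card_tableau_column_rectangle[OF t] y by (intro garnir[OF X t]) auto
  qed
  also have "(\<Sum>x\<in>tableau_column ?la t j - {y}. ?f x) = (\<Sum>x\<in>tableau_column ?la t j - {y}. - u)"
    unfolding u using j by (intro sum.cong refl transpose_tableau_column[OF X t]) auto
  also have "\<dots> + (\<Sum>i\<in>{..<l} - {j}. u) = (of_nat l - of_nat d) *\<^sub>F u"
  proof -
    \<comment> \<open>The lower bounds on \<open>d\<close> and \<open>l\<close> come from
      \<open>y\<close> lying in column \<open>j\<close>; they make the truncated subtractions
      exact.\<close>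
    have "card (tableau_column ?la t j - {y}) = d - 1" "d \<ge> 1"
      using card_tableau_column_rectangle[OF t j(1)] j(2) fin[of j] card_gt_0_iff[of "tableau_column ?la t j"]
      by auto
    moreover have "card ({..<l} - {j}) = l - 1" "l \<ge> 1" using j by auto
    ultimately show ?thesis
      unfolding sum_constant_fscale by (simp add: fun_eq_iff fscale_apply of_nat_diff algebra_simps)
  qed
  finally have "(\<Sum>x\<in>X - {y}. ?f x) = (of_nat l - of_nat d) *\<^sub>F u" .
  then show ?case
    unfolding permute_vec_add permute_vec_scale sum.distrib funvs.scale_sum_right[symmetric]
    by (simp only: step(2) funvs.scale_right_distrib funvs.scale_left_commute)
qed

subsection \<open>Antisymmetrizers\<close>

text \<open>This is the operator \<open>P\<^sub>Y\<close>, taken on vectors rather than in the group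
  algebra because the superset identities below are proved for vectors of the Specht module.\<close>

definition antisymmetrize :: "nat set \<Rightarrow> (tabloid \<Rightarrow> complex) \<Rightarrow> tabloid \<Rightarrow> complex"
  where "antisymmetrize Y v = (\<Sum>\<sigma> | \<sigma> permutes Y. of_int (sign \<sigma>) *\<^sub>F permute_vec \<sigma> v)"

lemma antisymmetrize_specht:
  assumes X: "finite X" and Y: "Y \<subseteq> X" and v: "v \<in> specht X la"
  shows "antisymmetrize Y v \<in> specht X la"
  unfolding antisymmetrize_def
  using permute_vec_specht[OF X _ v] permutes_subset[OF _ Y]
  by (intro funvs.subspace_sum subspace_specht funvs.subspace_scale) auto

text \<open>Left multiplication by the transposition is an involution on the permutations of
  \<open>Y\<close> that flips every sign.\<close>

lemma transpose_antisymmetrize: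
  assumes Y: "finite Y" and ab: "a \<in> Y" "b \<in> Y" "a \<noteq> b"
  shows "permute_vec (transpose a b) (antisymmetrize Y v) = - antisymmetrize Y v"
proof -
  let ?\<tau> = "transpose a b"
  have \<tau>: "?\<tau> permutes Y" using ab by (simp add: permutes_swap_id)
  have "permute_vec ?\<tau> (antisymmetrize Y v) =
      (\<Sum>\<sigma> | \<sigma> permutes Y. of_int (sign \<sigma>) *\<^sub>F permute_vec ?\<tau> (permute_vec \<sigma> v))"
    by (simp add: antisymmetrize_def permute_vec_sum permute_vec_scale)
  also have "\<dots> = (\<Sum>\<sigma> | \<sigma> permutes Y. - (of_int (sign \<sigma>) *\<^sub>F permute_vec \<sigma> v))"
  proof (rule sum.reindex_bij_witness[where i = "\<lambda>\<sigma>. ?\<tau> \<circ> \<sigma>" and j = "\<lambda>\<sigma>. ?\<tau> \<circ> \<sigma>"])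
    fix \<sigma> assume "\<sigma> \<in> {\<sigma>. \<sigma> permutes Y}"
    then have \<sigma>: "\<sigma> permutes Y" by simp
    show "?\<tau> \<circ> (?\<tau> \<circ> \<sigma>) = \<sigma>" by (simp add: comp_assoc[symmetric])
    then show "?\<tau> \<circ> (?\<tau> \<circ> \<sigma>) = \<sigma>" .
    show "?\<tau> \<circ> \<sigma> \<in> {\<sigma>. \<sigma> permutes Y}" using \<sigma> \<tau> by (simp add: permutes_compose)
    then show "?\<tau> \<circ> \<sigma> \<in> {\<sigma>. \<sigma> permutes Y}" .
    have "permutation \<sigma>" using \<sigma> Y by (auto simp: permutation_permutes)
    then have "sign (?\<tau> \<circ> \<sigma>) = - sign \<sigma>"
      using ab by (simp add: sign_compose permutation_swap_id sign_swap_id)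
    moreover have "permute_vec (?\<tau> \<circ> \<sigma>) v = permute_vec ?\<tau> (permute_vec \<sigma> v)"
      using \<sigma> by (simp add: permute_vec_comp permutes_bij)
    ultimately show "- (of_int (sign (?\<tau> \<circ> \<sigma>)) *\<^sub>F permute_vec (?\<tau> \<circ> \<sigma>) v) =
        of_int (sign \<sigma>) *\<^sub>F permute_vec ?\<tau> (permute_vec \<sigma> v)"
      by simp
  qed
  also have "\<dots> = - antisymmetrize Y v" by (simp only: antisymmetrize_def sum_negf)
  finally show ?thesis .
qed

text \<open>Coset decomposition: each permutation of \<open>insert x Y\<close> is uniquely
  \<open>transpose x y \<circ> \<sigma>\<close> with \<open>y\<close> in \<open>insert x Y\<close>
  and \<open>\<sigma>\<close> a permutation of \<open>Y\<close>. The choice \<open>y = x\<close>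
  gives the first term.\<close>

lemma antisymmetrize_insert:
  assumes Y: "finite Y" and x: "x \<notin> Y"
  shows "antisymmetrize (insert x Y) v =
    antisymmetrize Y v - (\<Sum>y\<in>Y. permute_vec (transpose x y) (antisymmetrize Y v))"
proof -
  have "antisymmetrize (insert x Y) v = (\<Sum>y\<in>insert x Y. \<Sum>\<sigma> | \<sigma> permutes Y.
      of_int (sign (transpose x y \<circ> \<sigma>)) *\<^sub>F permute_vec (transpose x y \<circ> \<sigma>) v)"
    unfolding antisymmetrize_def by (rule sum_over_permutations_insert[OF Y x])
  also have "\<dots> = (\<Sum>y\<in>insert x Y. of_int (sign (transpose x y)) *\<^sub>F
      permute_vec (transpose x y) (antisymmetrize Y v))"
  proof (rule sum.cong[OF refl])
    fix y
    have "(\<Sum>\<sigma> | \<sigma> permutes Y. of_int (sign (transpose x y \<circ> \<sigma>)) *\<^sub>F permute_vec (transpose x y \<circ> \<sigma>) v) =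
      (\<Sum>\<sigma> | \<sigma> permutes Y. of_int (sign (transpose x y)) *\<^sub>F of_int (sign \<sigma>) *\<^sub>F
        permute_vec (transpose x y) (permute_vec \<sigma> v))"
    proof (rule sum.cong[OF refl])
      fix \<sigma> assume "\<sigma> \<in> {\<sigma>. \<sigma> permutes Y}"
      then have "permutation \<sigma>" "bij \<sigma>"
        using Y by (auto simp: permutation_permutes permutes_bij)
      then show "of_int (sign (transpose x y \<circ> \<sigma>)) *\<^sub>F permute_vec (transpose x y \<circ> \<sigma>) v =
          of_int (sign (transpose x y)) *\<^sub>F of_int (sign \<sigma>) *\<^sub>F
          permute_vec (transpose x y) (permute_vec \<sigma> v)"
        by (simp add: sign_compose permutation_swap_id permute_vec_comp)
    qed
    then show "(\<Sum>\<sigma> | \<sigma> permutes Y.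
        of_int (sign (transpose x y \<circ> \<sigma>)) *\<^sub>F permute_vec (transpose x y \<circ> \<sigma>) v) =
        of_int (sign (transpose x y)) *\<^sub>F permute_vec (transpose x y) (antisymmetrize Y v)"
      by (simp only: antisymmetrize_def permute_vec_sum permute_vec_scale funvs.scale_sum_right)
  qed
  also have "\<dots> = antisymmetrize Y v +
      (\<Sum>y\<in>Y. of_int (sign (transpose x y)) *\<^sub>F permute_vec (transpose x y) (antisymmetrize Y v))"
    using Y x by (simp add: sign_id)
  also have "(\<Sum>y\<in>Y. of_int (sign (transpose x y)) *\<^sub>F permute_vec (transpose x y) (antisymmetrize Y v)) =
      (\<Sum>y\<in>Y. - permute_vec (transpose x y) (antisymmetrize Y v))"
    using x by (intro sum.cong refl) (auto simp: sign_swap_id)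
  finally show ?thesis by (simp only: sum_negf diff_conv_add_uminus)
qed

text \<open>After \<open>antisymmetrize_insert\<close> and an exchange of sums, every
  \<open>y\<close> in \<open>Y\<close> contributes the same scalar \<open>\<kappa>\<close>. The
  result \<open>(d * l - |Y|) - |Y| * \<kappa>\<close> factors as displayed.\<close>

lemma sum_antisymmetrize_insert:
  assumes X: "finite X" "card X = d * l" and v: "v \<in> specht X (replicate d l)" and Y: "Y \<subseteq> X"
  shows "(\<Sum>x\<in>X - Y. antisymmetrize (insert x Y) v) =
    ((of_nat d - of_nat (card Y)) * (of_nat l + of_nat (card Y))) *\<^sub>F antisymmetrize Y v"
proof -
  define u where "u = antisymmetrize Y v"
  have fY: "finite Y" using X Y finite_subset by blast
  have u: "u \<in> specht X (replicate d l)"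
    unfolding u_def by (rule antisymmetrize_specht[OF X(1) Y v])
  \<comment> \<open>All transpositions through \<open>y\<close> sum to \<open>l - d\<close> by
    \<open>jucys_murphy_rectangle\<close>; the \<open>|Y| - 1\<close> of them inside
    \<open>Y\<close> act by -1 each, and \<open>\<kappa>\<close> is what remains.\<close>
  define \<kappa> :: complex where "\<kappa> = of_nat l - of_nat d + of_nat (card Y) - 1"
  have inner: "(\<Sum>x\<in>X - Y. permute_vec (transpose x y) u) = \<kappa> *\<^sub>F u" if y: "y \<in> Y" for y
  proof -
    have "X - {y} = (X - Y) \<union> (Y - {y})" using y Y by blast
    then have "(\<Sum>x\<in>X - {y}. permute_vec (transpose x y) u) =
        (\<Sum>x\<in>X - Y. permute_vec (transpose x y) u) + (\<Sum>x\<in>Y - {y}. permute_vec (transpose x y) u)"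
      using X fY by (simp only:) (rule sum.union_disjoint; auto)
    moreover have "(\<Sum>x\<in>X - {y}. permute_vec (transpose x y) u) = (of_nat l - of_nat d) *\<^sub>F u"
      using jucys_murphy_rectangle[OF X(1) _ u] y Y by blast
    moreover have "(\<Sum>x\<in>Y - {y}. permute_vec (transpose x y) u) = (\<Sum>x\<in>Y - {y}. - u)"
      unfolding u_def using y fY by (intro sum.cong refl transpose_antisymmetrize) auto
    moreover have "card (Y - {y}) = card Y - 1" "card Y \<ge> 1"
      using y fY card_gt_0_iff[of Y] by auto
    ultimately show ?thesis
      unfolding sum_constant_fscale \<kappa>_def
      by (simp add: fun_eq_iff fscale_apply of_nat_diff algebra_simps)
  qed
  have "(\<Sum>x\<in>X - Y. antisymmetrize (insert x Y) v) =
      (\<Sum>x\<in>X - Y. u - (\<Sum>y\<in>Y. permute_vec (transpose x y) u))"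
    unfolding u_def using fY by (intro sum.cong refl antisymmetrize_insert) auto
  also have "\<dots> = (\<Sum>x\<in>X - Y. u) - (\<Sum>y\<in>Y. \<Sum>x\<in>X - Y. permute_vec (transpose x y) u)"
    unfolding sum_subtractf by (subst (2) sum.swap) (rule refl)
  also have "(\<Sum>y\<in>Y. \<Sum>x\<in>X - Y. permute_vec (transpose x y) u) = (\<Sum>y\<in>Y. \<kappa> *\<^sub>F u)"
    by (intro sum.cong refl inner)
  also have "(\<Sum>x\<in>X - Y. u) - (\<Sum>y\<in>Y. \<kappa> *\<^sub>F u) =
      ((of_nat d - of_nat (card Y)) * (of_nat l + of_nat (card Y))) *\<^sub>F u"
  proof -
    have "card (X - Y) = d * l - card Y" "card Y \<le> d * l"
      using X Y fY card_mono[OF X(1) Y] by (auto simp: card_Diff_subset)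
    then show ?thesis
      unfolding sum_constant_fscale \<kappa>_def
      by (simp add: fun_eq_iff fscale_apply of_nat_diff algebra_simps)
  qed
  finally show ?thesis unfolding u_def .
qed

section \<open>Sums over the supersets of a fixed size\<close>

abbreviation supersets :: "nat set \<Rightarrow> nat set \<Rightarrow> nat \<Rightarrow> nat set set"
  where "supersets X Y k \<equiv> {Z. Y \<subseteq> Z \<and> Z \<subseteq> X \<and> card Z = k}"

text \<open>Double counting of the pairs \<open>(Z, x)\<close> with \<open>Z = insert x W\<close>.
  The constant inner sum on the right records how often each \<open>Z\<close> is reached.\<close>

lemma sum_supersets_insert:
  fixes f :: "nat set \<Rightarrow> 'a::comm_monoid_add"
  assumes X: "finite X"
  shows "(\<Sum>W\<in>supersets X Y k. \<Sum>x\<in>X - W. f (insert x W)) =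
    (\<Sum>Z\<in>supersets X Y (Suc k). \<Sum>x\<in>Z - Y. f Z)"
proof -
  have fin: "finite (supersets X Y i)" for i
    using X by (auto intro: finite_subset[of _ "Pow X"])
  have "(\<Sum>W\<in>supersets X Y k. \<Sum>x\<in>X - W. f (insert x W)) =
      (\<Sum>(W, x)\<in>Sigma (supersets X Y k) (\<lambda>W. X - W). f (insert x W))"
    using fin X by (intro sum.Sigma) auto
  also have "\<dots> = (\<Sum>(Z, x)\<in>Sigma (supersets X Y (Suc k)) (\<lambda>Z. Z - Y). f Z)"
  proof (rule sum.reindex_bij_witness[where i = "\<lambda>(Z, x). (Z - {x}, x)" and j = "\<lambda>(W, x). (insert x W, x)"])
    fix p assume "p \<in> Sigma (supersets X Y k) (\<lambda>W. X - W)"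
    then obtain W x where p: "p = (W, x)" "Y \<subseteq> W" "W \<subseteq> X" "card W = k" "x \<in> X" "x \<notin> W"
      by auto
    moreover have "finite W" using p X finite_subset by blast
    ultimately show "(case (case p of (W, x) \<Rightarrow> (insert x W, x)) of (Z, x) \<Rightarrow> (Z - {x}, x)) = p"
      and "(case p of (W, x) \<Rightarrow> (insert x W, x)) \<in> Sigma (supersets X Y (Suc k)) (\<lambda>Z. Z - Y)"
      and "(case (case p of (W, x) \<Rightarrow> (insert x W, x)) of (Z, x) \<Rightarrow> f Z) =
        (case p of (W, x) \<Rightarrow> f (insert x W))"
      by auto
  next
    fix p assume "p \<in> Sigma (supersets X Y (Suc k)) (\<lambda>Z. Z - Y)"
    then obtain Z x where p: "p = (Z, x)" "Y \<subseteq> Z" "Z \<subseteq> X" "card Z = Suc k" "x \<in> Z" "x \<notin> Y"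
      by auto
    moreover have "finite Z" using p X finite_subset by blast
    ultimately show "(case (case p of (Z, x) \<Rightarrow> (Z - {x}, x)) of (W, x) \<Rightarrow> (insert x W, x)) = p"
      and "(case p of (Z, x) \<Rightarrow> (Z - {x}, x)) \<in> Sigma (supersets X Y k) (\<lambda>W. X - W)"
      by (auto simp: insert_absorb)
  qed
  also have "\<dots> = (\<Sum>Z\<in>supersets X Y (Suc k). \<Sum>x\<in>Z - Y. f Z)"
    using fin X by (intro sum.Sigma[symmetric]) (auto intro: finite_subset)
  finally show ?thesis .
qed

text \<open>Product of the one-step factors of \<open>sum_antisymmetrize_insert\<close> at the sizes
  \<open>j\<close>, ..., \<open>j + i - 1\<close>. The denominators multiply to the factorial of
  \<open>i\<close>, the number of orders in which \<open>i\<close> elements can be added.\<close>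

definition superset_coeff :: "nat \<Rightarrow> nat \<Rightarrow> nat \<Rightarrow> nat \<Rightarrow> complex"
  where "superset_coeff d l j i =
    (\<Prod>h<i. (of_nat d - of_nat (j + h)) * (of_nat l + of_nat (j + h)) / of_nat (Suc h))"

text \<open>Induction on the number of added elements. Enlarging all supersets with \<open>i\<close>
  extra elements by one more reaches each new superset \<open>Suc i\<close> times, which is then
  divided out.\<close>

lemma sum_antisymmetrize_supersets:
  assumes X: "finite X" "card X = d * l" and v: "v \<in> specht X (replicate d l)" and Y: "Y \<subseteq> X"
  shows "(\<Sum>Z\<in>supersets X Y (card Y + i). antisymmetrize Z v) =
    superset_coeff d l (card Y) i *\<^sub>F antisymmetrize Y v"
proof (induction i)
  case 0
  have "supersets X Y (card Y) = {Y}"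
  proof -
    have "Z = Y" if "Y \<subseteq> Z" "Z \<subseteq> X" "card Z = card Y" for Z
      using card_subset_eq[of Z Y] finite_subset[OF that(2) X(1)] that by simp
    then show ?thesis using Y by blast
  qed
  then show ?case by (simp add: superset_coeff_def)
next
  case (Suc i)
  let ?k = "card Y + i"
  let ?r = "(of_nat d - of_nat ?k) * (of_nat l + of_nat ?k) :: complex"
  have fY: "finite Y" using X Y finite_subset by blast
  have "of_nat (Suc i) *\<^sub>F (\<Sum>Z\<in>supersets X Y (Suc ?k). antisymmetrize Z v) =
      (\<Sum>Z\<in>supersets X Y (Suc ?k). \<Sum>x\<in>Z - Y. antisymmetrize Z v)"
    unfolding funvs.scale_sum_right
  proof (rule sum.cong[OF refl])
    fix Z assume "Z \<in> supersets X Y (Suc ?k)"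
    then have "card (Z - Y) = Suc i" using fY by (auto simp: card_Diff_subset)
    then show "of_nat (Suc i) *\<^sub>F antisymmetrize Z v = (\<Sum>x\<in>Z - Y. antisymmetrize Z v)"
      by (simp only: sum_constant_fscale)
  qed
  also have "\<dots> = (\<Sum>W\<in>supersets X Y ?k. \<Sum>x\<in>X - W. antisymmetrize (insert x W) v)"
    by (rule sum_supersets_insert[OF X(1), symmetric])
  also have "\<dots> = (\<Sum>W\<in>supersets X Y ?k. ?r *\<^sub>F antisymmetrize W v)"
    by (intro sum.cong refl) (auto simp: sum_antisymmetrize_insert[OF X v])
  also have "\<dots> = ?r *\<^sub>F superset_coeff d l (card Y) i *\<^sub>F antisymmetrize Y v"
    by (simp only: funvs.scale_sum_right[symmetric] Suc.IH)
  finally have eq: "of_nat (Suc i) *\<^sub>F (\<Sum>Z\<in>supersets X Y (Suc ?k). antisymmetrize Z v) =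
      ?r *\<^sub>F superset_coeff d l (card Y) i *\<^sub>F antisymmetrize Y v" .
  have "(\<Sum>Z\<in>supersets X Y (Suc ?k). antisymmetrize Z v) =
      inverse (of_nat (Suc i)) *\<^sub>F of_nat (Suc i) *\<^sub>F (\<Sum>Z\<in>supersets X Y (Suc ?k). antisymmetrize Z v)"
    by (simp del: of_nat_Suc)
  also have "\<dots> = superset_coeff d l (card Y) (Suc i) *\<^sub>F antisymmetrize Y v"
  proof -
    have "superset_coeff d l (card Y) (Suc i) =
        inverse (of_nat (Suc i)) * (?r * superset_coeff d l (card Y) i)"
      by (simp add: superset_coeff_def divide_inverse mult_ac del: of_nat_Suc of_nat_add)
    then show ?thesis unfolding eq by (simp only: funvs.scale_scale)
  qed
  finally show ?case by (simp only: add_Suc_right)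
qed

subsection \<open>The action of the group algebra\<close>

lemma ga_act_add: "ga_act n (x + y) v = ga_act n x v + ga_act n y v"
  unfolding ga_act_def plus_fun_apply funvs.scale_left_distrib sum.distrib ..

lemma ga_act_scale: "ga_act n (c *\<^sub>F x) v = c *\<^sub>F ga_act n x v"
  unfolding ga_act_def fscale_apply funvs.scale_sum_right funvs.scale_scale ..

lemma ga_act_zero: "ga_act n 0 v = 0"
  unfolding ga_act_def by (simp only: zero_fun_apply funvs.scale_zero_left sum.neutral_const)

lemma ga_act_sum: "ga_act n (\<Sum>i\<in>A. f i) v = (\<Sum>i\<in>A. ga_act n (f i) v)"
  by (induction A rule: infinite_finite_induct)
    (simp_all only: sum.infinite sum.empty sum.insert ga_act_zero ga_act_add not_False_eq_True)

lemma ga_act_delta: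
  assumes "\<sigma> permutes {1..n}"
  shows "ga_act n (delta \<sigma>) v = permute_vec \<sigma> v"
proof -
  have "ga_act n (delta \<sigma>) v = (\<Sum>\<tau> | \<tau> permutes {1..n}. if \<tau> = \<sigma> then permute_vec \<sigma> v else 0)"
    unfolding ga_act_def by (intro sum.cong refl) (auto simp: delta_def)
  also have "\<dots> = permute_vec \<sigma> v"
    using assms by (subst sum.delta) (auto simp: finite_permutations)
  finally show ?thesis .
qed

lemma ga_act_mult: "ga_act n (ga_mult n x y) v = ga_act n x (ga_act n y v)"
proof -
  have "ga_act n (ga_mult n x y) v = (\<Sum>\<sigma> | \<sigma> permutes {1..n}. \<Sum>\<tau> | \<tau> permutes {1..n}.
      (x \<sigma> * y \<tau>) *\<^sub>F permute_vec (\<sigma> \<circ> \<tau>) v)"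
    unfolding ga_mult_def ga_act_sum ga_act_scale
    by (intro sum.cong refl arg_cong2[where f = fscale] ga_act_delta) (simp add: permutes_compose)
  also have "\<dots> = (\<Sum>\<sigma> | \<sigma> permutes {1..n}. \<Sum>\<tau> | \<tau> permutes {1..n}.
      x \<sigma> *\<^sub>F y \<tau> *\<^sub>F permute_vec \<sigma> (permute_vec \<tau> v))"
    by (intro sum.cong refl) (simp add: permute_vec_comp permutes_bij)
  also have "\<dots> = ga_act n x (ga_act n y v)"
    unfolding ga_act_def permute_vec_sum permute_vec_scale funvs.scale_sum_right ..
  finally show ?thesis .
qed

lemma ga_act_specht: "v \<in> specht {1..n} la \<Longrightarrow> ga_act n x v \<in> specht {1..n} la"
  unfolding ga_act_def
  by (intro funvs.subspace_sum subspace_specht funvs.subspace_scale permute_vec_specht) auto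

text \<open>By \<open>specht_char_column\<close> the character is the sign, so each inner sum over
  permutations of \<open>X\<close> becomes an antisymmetrizer.\<close>

lemma ga_act_beta:
  "ga_act n (beta n z (replicate k 1) t) v =
    (\<Sum>X | X \<subseteq> {1..n} \<and> card X = k. (\<Prod>i\<in>{1..n} - X. z i + t) *\<^sub>F antisymmetrize X v)"
  unfolding beta_def antisymmetrize_def ga_act_sum ga_act_scale funvs.scale_sum_right
proof (rule sum.cong)
  show "{X. X \<subseteq> {1..n} \<and> card X = sum_list (replicate k 1)} = {X. X \<subseteq> {1..n} \<and> card X = k}"
    by (simp add: sum_list_replicate)
next
  fix X :: "nat set" assume "X \<in> {X. X \<subseteq> {1..n} \<and> card X = k}"
  then have X: "X \<subseteq> {1..n}" "finite X" "card X = k" by (auto intro: finite_subset)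
  show "(\<Sum>\<sigma> | \<sigma> permutes X. (specht_char X (replicate k 1) \<sigma> * (\<Prod>i\<in>{1..n} - X. z i + t)) *\<^sub>F
      ga_act n (delta \<sigma>) v) =
    (\<Sum>\<sigma> | \<sigma> permutes X. (\<Prod>i\<in>{1..n} - X. z i + t) *\<^sub>F of_int (sign \<sigma>) *\<^sub>F permute_vec \<sigma> v)"
  proof (rule sum.cong[OF refl])
    fix \<sigma> assume "\<sigma> \<in> {\<sigma>. \<sigma> permutes X}"
    then have \<sigma>: "\<sigma> permutes X" by simp
    then have "ga_act n (delta \<sigma>) v = permute_vec \<sigma> v"
      using permutes_subset[OF \<sigma> X(1)] by (rule_tac ga_act_delta)
    then show "(specht_char X (replicate k 1) \<sigma> * (\<Prod>i\<in>{1..n} - X. z i + t)) *\<^sub>F ga_act n (delta \<sigma>) v =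
        (\<Prod>i\<in>{1..n} - X. z i + t) *\<^sub>F of_int (sign \<sigma>) *\<^sub>F permute_vec \<sigma> v"
      by (simp only: specht_char_column[OF X(2,3) \<sigma>] funvs.scale_scale mult.commute)
  qed
qed

text \<open>For indices outside \<open>{1..n}\<close> a transformed parameter may be the unspecified
  \<open>coord Infty\<close>; this shows that such values do not affect the generators.\<close>

lemma beta_cong:
  assumes "\<And>i. i \<in> {1..n} \<Longrightarrow> z i = w i"
  shows "beta n z la t = beta n w la t"
proof -
  have "(\<Prod>i\<in>{1..n} - X. z i + t) = (\<Prod>i\<in>{1..n} - X. w i + t)" for X
    using assms by (intro prod.cong) auto
  then show ?thesis by (simp only: beta_def)
qed

subsection \<open>Moebius transformations of the parameters\<close>

text \<open>The choice of \<open>s\<close> gives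
  \<open>\<phi>(z i) + t = (a + t * c) * (z i + s) / (c * z i + e)\<close>. Clearing denominators
  puts the weight \<open>c * z i + e\<close> on the elements of \<open>X\<close>; its expansion over
  subsets \<open>Y\<close> and the superset sums then lead back to the original generators at
  \<open>s\<close>.\<close>

lemma beta_moebius_act:
  fixes a b c e t :: complex
  assumes n: "n = d * l" and v: "v \<in> specht {1..n} (replicate d l)"
    and nz: "\<And>i. i \<in> {1..n} \<Longrightarrow> c * z i + e \<noteq> 0" and A: "a + t * c \<noteq> 0"
  defines "s \<equiv> (b + t * e) / (a + t * c)"
  shows "ga_act n (beta n (\<lambda>i. (a * z i + b) / (c * z i + e)) (replicate k 1) t) v =
    (\<Sum>j\<le>k. ((a + t * c) ^ (n - k) / (\<Prod>i\<in>{1..n}. c * z i + e) * (e - c * s) ^ j * c ^ (k - j) *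
        superset_coeff d l j (k - j)) *\<^sub>F ga_act n (beta n z (replicate j 1) s) v)"
proof -
  define q where "q i = z i + s" for i
  define \<delta> where "\<delta> = e - c * s"
  \<comment> \<open>Using the denominators over all of \<open>{1..n}\<close> makes \<open>K\<close>
    independent of \<open>X\<close>; the factors for \<open>i\<close> in \<open>X\<close> have to be
    multiplied back.\<close>
  define K where "K = (a + t * c) ^ (n - k) / (\<Prod>i\<in>{1..n}. c * z i + e)"
  define F where "F = {X. X \<subseteq> {1..n} \<and> card X = k}"
  define G where "G Y = (K * \<delta> ^ card Y * c ^ (k - card Y)) * (\<Prod>i\<in>{1..n} - Y. q i)" for Y
  have finF: "finite F" unfolding F_def by (auto intro: finite_subset[of _ "Pow {1..n}"])
  have expand: "(\<Prod>i\<in>{1..n} - X. (a * z i + b) / (c * z i + e) + t) = (\<Sum>Y | Y \<in> Pow {1..n} \<and> Y \<subseteq> X. G Y)"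
    if X: "X \<in> F" for X
  proof -
    have X': "X \<subseteq> {1..n}" "card X = k" "finite X" using X by (auto simp: F_def intro: finite_subset)
    have "(a * z i + b) / (c * z i + e) + t = (a + t * c) * q i / (c * z i + e)" if "i \<in> {1..n} - X" for i
    proof -
      have "(a + t * c) * q i = (a + t * c) * z i + (b + t * e)"
        unfolding q_def s_def using A by (simp add: field_simps)
      moreover have "c * z i + e \<noteq> 0" using nz that by blast
      ultimately show ?thesis by (simp add: field_simps)
    qed
    then have "(\<Prod>i\<in>{1..n} - X. (a * z i + b) / (c * z i + e) + t) =
        (\<Prod>i\<in>{1..n} - X. (a + t * c) * q i / (c * z i + e))"
      by (rule prod.cong[OF refl])
    also have "\<dots> = (a + t * c) ^ (n - k) * (\<Prod>i\<in>{1..n} - X. q i) / (\<Prod>i\<in>{1..n} - X. c * z i + e)"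
      using X' by (simp add: prod_dividef prod.distrib card_Diff_subset)
    also have "\<dots> = K * (\<Prod>i\<in>X. c * z i + e) * (\<Prod>i\<in>{1..n} - X. q i)"
    proof -
      have "(\<Prod>i\<in>{1..n}. c * z i + e) = (\<Prod>i\<in>{1..n} - X. c * z i + e) * (\<Prod>i\<in>X. c * z i + e)"
        using X' by (intro prod.subset_diff) auto
      moreover have "(\<Prod>i\<in>X. c * z i + e) \<noteq> 0" using nz X' by auto
      ultimately show ?thesis unfolding K_def by simp
    qed
    also have "(\<Prod>i\<in>X. c * z i + e) = (\<Prod>i\<in>X. \<delta> + c * q i)"
      by (simp add: \<delta>_def q_def algebra_simps)
    \<comment> \<open>Here \<open>Y\<close> collects the factors from which \<open>\<delta>\<close>
      is taken. The factors \<open>q i\<close> left over from \<open>X - Y\<close> join those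
      outside \<open>X\<close> to form the product over the complement of \<open>Y\<close>, so
      \<open>G Y\<close> no longer mentions \<open>X\<close>.\<close>
    also have "\<dots> = (\<Sum>Y\<in>Pow X. \<delta> ^ card Y * (c ^ (k - card Y) * (\<Prod>i\<in>X - Y. q i)))"
      unfolding prod_add[OF X'(3)] using X'
      by (intro sum.cong refl) (auto simp: prod.distrib card_Diff_subset finite_subset)
    also have "K * \<dots> * (\<Prod>i\<in>{1..n} - X. q i) = (\<Sum>Y\<in>Pow X. G Y)"
      unfolding sum_distrib_left sum_distrib_right
    proof (rule sum.cong[OF refl])
      fix Y assume Y: "Y \<in> Pow X"
      have "{1..n} - Y - ({1..n} - X) = X - Y" using Y X' by auto
      then have "(\<Prod>i\<in>{1..n} - Y. q i) = (\<Prod>i\<in>X - Y. q i) * (\<Prod>i\<in>{1..n} - X. q i)"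
        using Y prod.subset_diff[of "{1..n} - X" "{1..n} - Y" q] by auto
      then show "K * (\<delta> ^ card Y * (c ^ (k - card Y) * (\<Prod>i\<in>X - Y. q i))) * (\<Prod>i\<in>{1..n} - X. q i) = G Y"
        by (simp add: G_def)
    qed
    also have "Pow X = {Y. Y \<in> Pow {1..n} \<and> Y \<subseteq> X}" using X' by auto
    finally show ?thesis .
  qed
  have "ga_act n (beta n (\<lambda>i. (a * z i + b) / (c * z i + e)) (replicate k 1) t) v =
      (\<Sum>X\<in>F. \<Sum>Y | Y \<in> Pow {1..n} \<and> Y \<subseteq> X. G Y *\<^sub>F antisymmetrize X v)"
    unfolding ga_act_beta F_def[symmetric] funvs.scale_sum_left[symmetric]
    by (intro sum.cong refl arg_cong2[where f = fscale] expand)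
  also have "\<dots> = (\<Sum>Y\<in>Pow {1..n}. \<Sum>X | X \<in> F \<and> Y \<subseteq> X. G Y *\<^sub>F antisymmetrize X v)"
    using finF by (intro sum.swap_restrict) auto
  \<comment> \<open>The conditional groups the subsets by size, so that each \<open>j\<close> can be
    matched with one generator. Subsets with more than \<open>k\<close> elements have no superset in
    \<open>F\<close> and give zero.\<close>
  also have "\<dots> = (\<Sum>Y\<in>Pow {1..n}. \<Sum>j\<le>k. if card Y = j then
      (G Y * superset_coeff d l j (k - j)) *\<^sub>F antisymmetrize Y v else 0)"
  proof (rule sum.cong[OF refl])
    fix Y assume Y: "Y \<in> Pow {1..n}"
    have eq: "{X. X \<in> F \<and> Y \<subseteq> X} = supersets {1..n} Y k" by (auto simp: F_def)
    show "(\<Sum>X | X \<in> F \<and> Y \<subseteq> X. G Y *\<^sub>F antisymmetrize X v) =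
      (\<Sum>j\<le>k. if card Y = j then (G Y * superset_coeff d l j (k - j)) *\<^sub>F antisymmetrize Y v else 0)"
    proof (cases "card Y \<le> k")
      case True
      have "(\<Sum>X | X \<in> F \<and> Y \<subseteq> X. G Y *\<^sub>F antisymmetrize X v) =
          G Y *\<^sub>F superset_coeff d l (card Y) (k - card Y) *\<^sub>F antisymmetrize Y v"
        unfolding eq funvs.scale_sum_right[symmetric]
        using sum_antisymmetrize_supersets[of "{1..n}" d l v Y "k - card Y"] n v Y True by simp
      then show ?thesis using True by simp
    next
      case False
      then have emp: "supersets {1..n} Y k = {}"
        using card_mono[OF finite_subset[OF _ finite_atLeastAtMost], of _ 1 n Y] by auto
      show ?thesis using False unfolding eq emp by simp
    qed
  qed
  also have "\<dots> = (\<Sum>j\<le>k. \<Sum>Y\<in>Pow {1..n}. if card Y = j then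
      (G Y * superset_coeff d l j (k - j)) *\<^sub>F antisymmetrize Y v else 0)"
    by (rule sum.swap)
  also have "\<dots> = (\<Sum>j\<le>k. (K * \<delta> ^ j * c ^ (k - j) * superset_coeff d l j (k - j)) *\<^sub>F
      ga_act n (beta n z (replicate j 1) s) v)"
  proof (rule sum.cong[OF refl])
    fix j
    have "(\<Sum>Y\<in>Pow {1..n}. if card Y = j then
        (G Y * superset_coeff d l j (k - j)) *\<^sub>F antisymmetrize Y v else 0) =
        (\<Sum>Y | Y \<in> Pow {1..n} \<and> card Y = j. (G Y * superset_coeff d l j (k - j)) *\<^sub>F antisymmetrize Y v)"
      by (rule sum.inter_filter[symmetric]) simp
    also have "\<dots> = (\<Sum>Y | Y \<subseteq> {1..n} \<and> card Y = j. (K * \<delta> ^ j * c ^ (k - j) * superset_coeff d l j (k - j)) *\<^sub>F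
        (\<Prod>i\<in>{1..n} - Y. z i + s) *\<^sub>F antisymmetrize Y v)"
      by (intro sum.cong) (auto simp: G_def q_def mult_ac)
    finally show "(\<Sum>Y\<in>Pow {1..n}. if card Y = j then
        (G Y * superset_coeff d l j (k - j)) *\<^sub>F antisymmetrize Y v else 0) =
        (K * \<delta> ^ j * c ^ (k - j) * superset_coeff d l j (k - j)) *\<^sub>F ga_act n (beta n z (replicate j 1) s) v"
      unfolding ga_act_beta funvs.scale_sum_right .
  qed
  finally show ?thesis unfolding K_def \<delta>_def .
qed

section \<open>Interpolation in the parameter of the generators\<close>

text \<open>The \<open>N\<close>-th finite difference of a polynomial of degree below
  \<open>N\<close> vanishes. The induction splits one factor \<open>f x + i\<close>: the part
  \<open>f x\<close> repeats the sum for \<open>S\<close>, and the part \<open>i\<close> is absorbed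
  into the binomial coefficient, lowering \<open>N\<close> by one.\<close>

lemma alternating_binomial_sum_prod:
  fixes f :: "'a \<Rightarrow> complex"
  assumes "finite S" "card S < N"
  shows "(\<Sum>i\<le>N. (-1) ^ i * of_nat (N choose i) * (\<Prod>s\<in>S. f s + of_nat i)) = 0"
  using assms
proof (induction S arbitrary: N f rule: finite_induct)
  case empty
  then show ?case using choose_alternating_sum[of N, where 'a = complex] by simp
next
  case (insert x S)
  then obtain M where N: "N = Suc M" "card S < M" by (cases N) auto
  define g where "g i = (\<Prod>s\<in>S. f s + of_nat i)" for i
  have "(\<Sum>i\<le>N. (-1) ^ i * of_nat (N choose i) * (\<Prod>s\<in>insert x S. f s + of_nat i)) =
      (\<Sum>i\<le>N. f x * ((-1) ^ i * of_nat (N choose i) * g i) +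
        of_nat i * ((-1) ^ i * of_nat (N choose i) * g i))"
    using insert.hyps by (intro sum.cong refl) (simp add: g_def algebra_simps)
  also have "\<dots> = f x * (\<Sum>i\<le>N. (-1) ^ i * of_nat (N choose i) * g i) +
      (\<Sum>i\<le>N. of_nat i * ((-1) ^ i * of_nat (N choose i) * g i))"
    by (simp add: sum.distrib sum_distrib_left)
  also have "(\<Sum>i\<le>N. (-1) ^ i * of_nat (N choose i) * g i) = 0"
    unfolding g_def using N by (intro insert.IH) simp
  also have "(\<Sum>i\<le>N. of_nat i * ((-1) ^ i * of_nat (N choose i) * g i)) =
      (\<Sum>i\<le>M. of_nat (Suc i) * ((-1) ^ Suc i * of_nat (Suc M choose Suc i) * g (Suc i)))"
    unfolding N by (subst sum.atMost_Suc_shift) simp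
  \<comment> \<open>The absorption identity extracts \<open>Suc M\<close>, and the index shift turns
    \<open>f\<close> into \<open>f + 1\<close>; this is why the induction is over arbitrary
    \<open>f\<close>.\<close>
  also have "\<dots> = (\<Sum>i\<le>M. - of_nat (Suc M) * ((-1) ^ i * of_nat (M choose i) * (\<Prod>s\<in>S. (f s + 1) + of_nat i)))"
  proof (rule sum.cong[OF refl])
    fix i
    have gS: "g (Suc i) = (\<Prod>s\<in>S. (f s + 1) + of_nat i)"
      by (simp add: g_def add.assoc)
    have "of_nat (Suc i) * (of_nat (Suc M choose Suc i) :: complex) = of_nat (Suc M) * of_nat (M choose i)"
      using Suc_times_binomial[of i M] by (metis of_nat_mult)
    then have "of_nat (Suc i) * ((-1) ^ Suc i * of_nat (Suc M choose Suc i) * g (Suc i)) =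
        - (of_nat (Suc M) * of_nat (M choose i)) * (-1) ^ i * g (Suc i)"
      by (metis (no_types, opaque_lifting) mult.assoc mult.commute mult_minus_left mult_1 power_Suc)
    then show "of_nat (Suc i) * ((-1) ^ Suc i * of_nat (Suc M choose Suc i) * g (Suc i)) =
        - of_nat (Suc M) * ((-1) ^ i * of_nat (M choose i) * (\<Prod>s\<in>S. (f s + 1) + of_nat i))"
      by (simp only: gS mult_ac mult_minus_left mult_minus_right)
  qed
  also have "\<dots> = 0"
    by (simp only: sum_distrib_left[symmetric] insert.IH[OF N(2)] mult_zero_right)
  finally show ?case by simp
qed

text \<open>A polynomial in \<open>t\<close> of degree at most \<open>n\<close> is recovered from its values at
  \<open>t + 1, \<dots>, t + n + 1\<close>; this reaches the one parameter that corresponds to infinity.\<close>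

lemma beta_interpolation:
  "beta n z la t = (\<Sum>i\<le>n. ((-1) ^ i * of_nat (Suc n choose Suc i)) *\<^sub>F beta n z la (t + of_nat (Suc i)))"
proof -
  have prod: "(\<Prod>i\<in>{1..n} - X. z i + t) =
      (\<Sum>i\<le>n. ((-1) ^ i * of_nat (Suc n choose Suc i)) * (\<Prod>j\<in>{1..n} - X. z j + (t + of_nat (Suc i))))" for X
  proof -
    have "card ({1..n} - X) \<le> card {1..n}" by (rule card_mono) auto
    \<comment> \<open>At most \<open>n\<close> factors depend on the parameter, so a difference of
      order \<open>Suc n\<close> vanishes. Solving for its term \<open>i = 0\<close> turns the signs
      into \<open>(-1) ^ i\<close> after the shift.\<close>
    then have "(\<Sum>i\<le>Suc n. (-1) ^ i * of_nat (Suc n choose i) * (\<Prod>j\<in>{1..n} - X. (z j + t) + of_nat i)) = 0"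
      by (intro alternating_binomial_sum_prod) auto
    then show ?thesis
      by (subst (asm) sum.atMost_Suc_shift) (simp add: sum_negf add.assoc del: binomial_Suc_Suc)
  qed
  have "beta n z la t = (\<Sum>X | X \<subseteq> {1..n} \<and> card X = sum_list la. \<Sum>\<sigma> | \<sigma> permutes X. \<Sum>i\<le>n.
      ((-1) ^ i * of_nat (Suc n choose Suc i)) *\<^sub>F
      (specht_char X la \<sigma> * (\<Prod>j\<in>{1..n} - X. z j + (t + of_nat (Suc i)))) *\<^sub>F delta \<sigma>)"
    unfolding beta_def funvs.scale_scale funvs.scale_sum_left[symmetric]
    by (subst prod) (simp only: sum_distrib_left mult.left_commute)
  also have "\<dots> = (\<Sum>X | X \<subseteq> {1..n} \<and> card X = sum_list la. \<Sum>i\<le>n. \<Sum>\<sigma> | \<sigma> permutes X.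
      ((-1) ^ i * of_nat (Suc n choose Suc i)) *\<^sub>F
      (specht_char X la \<sigma> * (\<Prod>j\<in>{1..n} - X. z j + (t + of_nat (Suc i)))) *\<^sub>F delta \<sigma>)"
    by (intro sum.cong refl sum.swap)
  also have "\<dots> = (\<Sum>i\<le>n. ((-1) ^ i * of_nat (Suc n choose Suc i)) *\<^sub>F beta n z la (t + of_nat (Suc i)))"
    unfolding beta_def funvs.scale_sum_right by (rule sum.swap)
  finally show ?thesis .
qed

section \<open>Comparison of two Bethe algebras on the Specht module\<close>

lemma bethe_sum:
  assumes "\<And>i. i \<in> A \<Longrightarrow> f i \<in> bethe n z"
  shows "(\<Sum>i\<in>A. f i) \<in> bethe n z"
proof -
  \<comment> \<open>Zero is not among the introduction rules, so the empty sum is obtained as a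
    multiple of the unit.\<close>
  have "0 *\<^sub>F delta id \<in> bethe n z" by (intro bethe.scale bethe.one)
  then have 0: "0 \<in> bethe n z" by (simp only: funvs.scale_zero_left)
  show ?thesis
    using assms by (induction A rule: infinite_finite_induct)
      (use 0 in \<open>simp_all only: sum.infinite sum.empty sum.insert not_False_eq_True\<close>, blast intro: bethe.add)
qed

text \<open>Rule induction shows that each element of \<open>bethe n w\<close> acts on the Specht
  module like some element of \<open>bethe n z\<close>. Agreement there suffices, since
  \<open>bethe_on\<close> records only restrictions.\<close>

lemma bethe_on_moebius_subset:
  fixes a b c e :: complex
  assumes n: "n = d * l" and det: "a * e - b * c \<noteq> 0"
    and nz: "\<And>i. i \<in> {1..n} \<Longrightarrow> c * z i + e \<noteq> 0"
    and w: "\<And>i. i \<in> {1..n} \<Longrightarrow> w i = (a * z i + b) / (c * z i + e)"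
  shows "bethe_on n (replicate d l) w \<subseteq> bethe_on n (replicate d l) z"
proof -
  let ?M = "specht {1..n} (replicate d l)"
  have generator_regular: "\<exists>x'\<in>bethe n z. \<forall>v\<in>?M. ga_act n (beta n w (replicate k 1) t) v = ga_act n x' v"
    if A: "a + t * c \<noteq> 0" for k t
  proof -
    have eq: "beta n w (replicate k 1) t = beta n (\<lambda>i. (a * z i + b) / (c * z i + e)) (replicate k 1) t"
      by (rule beta_cong) (rule w)
    show ?thesis
      unfolding eq
      \<comment> \<open>The witness stays schematic: the right side of
        \<open>beta_moebius_act\<close> is folded into the action of a single sum, and reflexivity
        then instantiates it.\<close>
      by (rule bexI, rule ballI, subst beta_moebius_act[OF n _ nz A],
          assumption, assumption, subst ga_act_scale[symmetric], subst ga_act_sum[symmetric], rule refl)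
        (intro bethe_sum bethe.scale bethe.gen)
  qed
  have generator: "\<exists>x'\<in>bethe n z. \<forall>v\<in>?M. ga_act n (beta n w (replicate k 1) t) v = ga_act n x' v" for k t
  proof (cases "a + t * c = 0")
    case False
    then show ?thesis by (rule generator_regular)
  next
    \<comment> \<open>This is the parameter for which \<open>s\<close> would be infinite.
      Invertibility forces \<open>c\<close> to be nonzero, so all the shifts
      \<open>t + Suc i\<close> are regular and interpolation from them reaches
      \<open>t\<close>.\<close>
    case True
    then have "c \<noteq> 0" using det by (auto simp: add_eq_0_iff)
    then have "a + (t + of_nat (Suc i)) * c \<noteq> 0" for i
      using True by (simp add: distrib_right flip: add.assoc del: of_nat_Suc)
    then have "\<forall>i. \<exists>x'. x' \<in> bethe n z \<and>
        (\<forall>v\<in>?M. ga_act n (beta n w (replicate k 1) (t + of_nat (Suc i))) v = ga_act n x' v)"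
      using generator_regular by blast
    then obtain x' where x': "\<And>i. x' i \<in> bethe n z"
      "\<And>i v. v \<in> ?M \<Longrightarrow> ga_act n (beta n w (replicate k 1) (t + of_nat (Suc i))) v = ga_act n (x' i) v"
      by metis
    define y where "y = (\<Sum>i\<le>n. ((-1) ^ i * of_nat (Suc n choose Suc i)) *\<^sub>F x' i)"
    have "y \<in> bethe n z" unfolding y_def by (intro bethe_sum bethe.scale x')
    moreover have "ga_act n (beta n w (replicate k 1) t) v = ga_act n y v" if "v \<in> ?M" for v
      unfolding y_def
      by (subst beta_interpolation) (simp only: ga_act_sum ga_act_scale x'(2)[OF that])
    ultimately show ?thesis by blast
  qed
  have rep: "\<exists>x'\<in>bethe n z. \<forall>v\<in>?M. ga_act n x v = ga_act n x' v" if "x \<in> bethe n w" for x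
    using that
  proof induction
    case (gen k t)
    show ?case by (rule generator)
  next
    case one
    show ?case by (rule bexI[OF _ bethe.one]) simp
  next
    case (scale x c)
    then obtain x' where "x' \<in> bethe n z" "\<forall>v\<in>?M. ga_act n x v = ga_act n x' v" by blast
    then show ?case
      by (intro bexI[of _ "c *\<^sub>F x'"]) (simp_all add: ga_act_scale bethe.scale)
  next
    case (add x y)
    then obtain x' y' where "x' \<in> bethe n z" "\<forall>v\<in>?M. ga_act n x v = ga_act n x' v"
        "y' \<in> bethe n z" "\<forall>v\<in>?M. ga_act n y v = ga_act n y' v" by blast
    then show ?case
      by (intro bexI[of _ "x' + y'"] ballI) (simp_all only: ga_act_add bethe.add)
  next
    case (mult x y)
    then obtain x' y' where "x' \<in> bethe n z" "\<forall>v\<in>?M. ga_act n x v = ga_act n x' v"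
        "y' \<in> bethe n z" "\<forall>v\<in>?M. ga_act n y v = ga_act n y' v" by blast
    \<comment> \<open>The hypothesis on \<open>x\<close> applies to \<open>ga_act n y' v\<close>
      because the Specht module is invariant under the action.\<close>
    then show ?case
      by (intro bexI[of _ "ga_mult n x' y'"] ballI) (simp_all del: One_nat_def add: ga_act_mult ga_act_specht bethe.mult)
  qed
  show ?thesis
    unfolding bethe_on_def
  proof (rule image_subsetI)
    fix x assume "x \<in> bethe n w"
    from rep[OF this] obtain x' where x': "x' \<in> bethe n z" "\<forall>v\<in>?M. ga_act n x v = ga_act n x' v"
      by (elim bexE)
    have "restrict (ga_act n x) ?M = restrict (ga_act n x') ?M"
      by (rule restrict_ext) (rule bspec[OF x'(2)])
    then show "restrict (ga_act n x) ?M \<in> (\<lambda>x. restrict (ga_act n x) ?M) ` bethe n z"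
      using x'(1) by blast
  qed
qed

text \<open>The inclusion of \<open>bethe_on_moebius_subset\<close> is applied to a matrix
  representing \<open>\<phi>\<close> and then to its adjugate, which represents the inverse.\<close>

theorem corollary5p22:
  fixes d m n :: nat and nu :: "nat list" and z :: "nat \<Rightarrow> complex" and \<phi> :: pgl2
  assumes "d \<le> m"
    and "nu = replicate d (m - d)"
    and "n = d * (m - d)"
    and "\<forall>i\<in>{1..n}. moebius \<phi> (Fin (z i)) \<noteq> Infty"
  shows "bethe_on n nu z = bethe_on n nu (\<lambda>i. coord (moebius \<phi> (Fin (z i))))"
proof -
  define A where "A = rep_pgl2 \<phi>"
  define a b c e where "a = A $ 1 $ 1" and "b = A $ 1 $ 2" and "c = A $ 2 $ 1" and "e = A $ 2 $ 2"
  define w where "w i = coord (moebius \<phi> (Fin (z i)))" for i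
  \<comment> \<open>For the partial quotient, a representative is related to itself, and this
    self-relation carries invertibility.\<close>
  have "proportional A A"
    unfolding A_def using Quotient3_rep_reflp[OF Quotient3_pgl2] .
  then have "invertible A" by (simp add: proportional_def)
  then have det: "a * e - b * c \<noteq> 0"
    by (simp add: invertible_det_nz det_2 a_def b_def c_def e_def)
  have moebius: "moebius \<phi> (Fin x) = (if c * x + e = 0 then Infty else Fin ((a * x + b) / (c * x + e)))" for x
    unfolding moebius.rep_eq A_def[symmetric] by (simp add: moebius_mat_def a_def b_def c_def e_def)
  have nz: "c * z i + e \<noteq> 0" if "i \<in> {1..n}" for i
    using assms(4) that by (auto simp: moebius split: if_splits)
  have w: "w i = (a * z i + b) / (c * z i + e)" if "i \<in> {1..n}" for i
    using nz[OF that] by (simp add: w_def moebius)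
  \<comment> \<open>The adjugate has rows \<open>(e, -b)\<close> and \<open>(-c, a)\<close>. Its
    denominator at \<open>w i\<close> is the determinant divided by \<open>c * z i + e\<close>,
    hence nonzero.\<close>
  have inv: "(- c) * w i + a \<noteq> 0" "z i = (e * w i + - b) / ((- c) * w i + a)" if "i \<in> {1..n}" for i
  proof -
    have "(- c) * w i + a = (a * e - b * c) / (c * z i + e)"
      using nz[OF that] by (simp add: w[OF that] field_simps)
    moreover have "e * w i + - b = (a * e - b * c) * z i / (c * z i + e)"
      using nz[OF that] by (simp add: w[OF that] field_simps)
    ultimately show "(- c) * w i + a \<noteq> 0" "z i = (e * w i + - b) / ((- c) * w i + a)"
      using det nz[OF that] by simp_all
  qed
  have "bethe_on n nu w \<subseteq> bethe_on n nu z"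
    unfolding assms(2) by (rule bethe_on_moebius_subset[OF assms(3) det nz w])
  moreover have "bethe_on n nu z \<subseteq> bethe_on n nu w"
    unfolding assms(2)
    by (rule bethe_on_moebius_subset[OF assms(3) _ inv]) (use det in \<open>simp_all add: algebra_simps\<close>)
  ultimately show ?thesis unfolding w_def by blast
qed

end
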